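(* For every $C>0$ there exists a constant $K>0$, depending only on $C$, such that the following holds. Let $n$ be a positive integer and let $X$ be a $[-1,1]^n$-valued random vector whose law $\mu$ satisfies the approximate tensorization property $AT(C)$. Then $X$ satisfies the dimension-free convex concentration property with constant $K$.
   Context: Approximate tensorization of entropy. For a probability measure $\nu$ and a nonnegative measurable function $f$, $\mathrm{Ent}_\nu(f)=\mathbb{E}_\nu f\log f-\mathbb{E}_\nu f\log\mathbb{E}_\nu f$ if $\mathbb{E}_\nu f\log f<\infty$, and $\mathrm{Ent}_\nu(f)=\infty$ otherwise. Let $\mu$ be a probability measure on $\mathcal{X}=[-1,1]^n$. For $x\in\mathcal{X}$ let $\bar x_i=(x_j)_{j\ne i}$ and let $\mu_i(\cdot|\bar x_i)$ be the regular conditional distribution under $\mu$ of the $i$-th coordinate given the other coordinates $\bar x_i$. The measure $\mu$ satisfies $AT(C)$ if for every (measurable) function $f\colon\mathcal{X}\to[0,\infty)$, $$\mathrm{Ent}_\mu(f)\le C\,\mathbb{E}_\mu\sum_{i=1}^n\mathrm{Ent}_{\mu_i(\cdot|\bar x_i)}(f),$$ where in the $i$-th term $f$ is regarded as a function of its $i$-th coordinate with $\bar x_i$ fixed. Convex concentration. A random vector $Y$ in $\mathbb{R}^m$ has the convex concentration property with constant $K$ if for every $L>0$, every convex function $f\colon\mathbb{R}^m\to\mathbb{R}$ that is $L$-Lipschitz with respect to the Euclidean norm, and every $t>0$, $$\mathbb{P}(|f(Y)-\mathrm{Med}\,f(Y)|\ge t)\le2\exp\big(-t^2/(K^2L^2)\big),$$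 where $\mathrm{Med}$ denotes a median (when the median is not unique, the inequality is understood for every median). A random vector $Z$ in $\mathbb{R}^n$ satisfies the dimension-free convex concentration property with constant $K$ if for every positive integer $N$ the random vector $(Z_1,\dots,Z_N)$ in $\mathbb{R}^{nN}$, where $Z_1,\dots,Z_N$ are i.i.d. copies of $Z$, has the convex concentration property with constant $K$. *)

theory Defs
  imports "HOL-Probability.Probability"
begin

section \<open>Entropy and approximate tensorization\<close>

text \<open>
  For nonnegative measurable f and a probability measure, the negative part of f log f is bounded
  by 1/e, so \<open>E f log f < \<infinity>\<close> is integrability of f log f, and it entails integrability of f.
  The convention 0 log 0 = 0 holds because \<open>ln 0 = 0\<close>. In the first branch the real number is
  nonnegative by Jensen's inequality, so \<open>ennreal\<close> does not truncate.
\<close>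

definition Ent :: "'a measure \<Rightarrow> ('a \<Rightarrow> real) \<Rightarrow> ennreal" where
  "Ent \<nu> f =
     (if integrable \<nu> (\<lambda>x. f x * ln (f x))
      then ennreal ((\<integral>x. f x * ln (f x) \<partial>\<nu>) - (\<integral>x. f x \<partial>\<nu>) * ln (\<integral>x. f x \<partial>\<nu>))
      else \<infinity>)"

abbreviation unit_seg :: "real measure" where
  "unit_seg \<equiv> restrict_space borel {-1..1}"

text \<open>
  The cube \<open>[-1,1]\<^sup>I\<close> with its Borel sets. Since the dimension must be quantified inside a
  formula, vectors are functions on an explicit finite index set, \<open>undefined\<close> off that set.
\<close>

abbreviation cube :: "nat set \<Rightarrow> (nat \<Rightarrow> real) measure" where
  "cube I \<equiv> PiM I (\<lambda>_. unit_seg)"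

definition omit :: "nat \<Rightarrow> nat \<Rightarrow> (nat \<Rightarrow> real) \<Rightarrow> (nat \<Rightarrow> real)" where
  "omit n i x = restrict x ({..<n} - {i})"

text \<open>
  \<open>\<kappa>\<close> is a version of the regular conditional distribution of the i-th coordinate given the others.
\<close>

definition regular_cond_dist ::
  "nat \<Rightarrow> (nat \<Rightarrow> real) measure \<Rightarrow> nat \<Rightarrow> ((nat \<Rightarrow> real) \<Rightarrow> real measure) \<Rightarrow> bool" where
  "regular_cond_dist n \<mu> i \<kappa> \<longleftrightarrow>
     \<kappa> \<in> cube ({..<n} - {i}) \<rightarrow>\<^sub>M prob_algebra unit_seg \<and>
     (\<forall>A \<in> sets (cube ({..<n} - {i})). \<forall>B \<in> sets unit_seg.
        emeasure \<mu> {x \<in> space \<mu>. omit n i x \<in> A \<and> x i \<in> B} =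
        (\<integral>\<^sup>+x. emeasure (\<kappa> (omit n i x)) B * indicator A (omit n i x) \<partial>\<mu>))"

text \<open>
  Regular conditional distributions exist on the cube and any two versions agree almost surely, so
  the property below does not depend on the choice of the kernels.
\<close>

definition AT :: "nat \<Rightarrow> real \<Rightarrow> (nat \<Rightarrow> real) measure \<Rightarrow> bool" where
  "AT n C \<mu> \<longleftrightarrow>
     (\<exists>\<kappa>. (\<forall>i<n. regular_cond_dist n \<mu> i (\<kappa> i)) \<and>
       (\<forall>f \<in> borel_measurable (cube {..<n}). (\<forall>x \<in> space (cube {..<n}). 0 \<le> f x) \<longrightarrow>
          Ent \<mu> f \<le>
            ennreal C * (\<integral>\<^sup>+x. (\<Sum>i<n. Ent (\<kappa> i (omit n i x)) (\<lambda>s. f (x(i := s)))) \<partial>\<mu>)))"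


section \<open>Convex concentration\<close>

text \<open>
  Functions on \<open>\<real>\<^sup>I\<close> for a finite index set I; the points of \<open>\<real>\<^sup>I\<close> are the elements of
  \<open>extensional I\<close>, for which the library has no vector space structure.
\<close>

definition convex_fun :: "'i set \<Rightarrow> (('i \<Rightarrow> real) \<Rightarrow> real) \<Rightarrow> bool" where
  "convex_fun I f \<longleftrightarrow>
     (\<forall>x \<in> extensional I. \<forall>y \<in> extensional I. \<forall>t \<in> {0..1}.
        f (\<lambda>i\<in>I. (1 - t) * x i + t * y i) \<le> (1 - t) * f x + t * f y)"

definition lipschitz_fun :: "real \<Rightarrow> 'i set \<Rightarrow> (('i \<Rightarrow> real) \<Rightarrow> real) \<Rightarrow> bool" where
  "lipschitz_fun L I f \<longleftrightarrow>
     (\<forall>x \<in> extensional I. \<forall>y \<in> extensional I.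
        \<bar>f x - f y\<bar> \<le> L * L2_set (\<lambda>i. x i - y i) I)"

definition is_median :: "'a measure \<Rightarrow> ('a \<Rightarrow> real) \<Rightarrow> real \<Rightarrow> bool" where
  "is_median M g m \<longleftrightarrow>
     measure M {\<omega> \<in> space M. g \<omega> \<le> m} \<ge> 1/2 \<and> measure M {\<omega> \<in> space M. g \<omega> \<ge> m} \<ge> 1/2"

definition convex_concentration ::
  "'i set \<Rightarrow> 'a measure \<Rightarrow> ('a \<Rightarrow> 'i \<Rightarrow> real) \<Rightarrow> real \<Rightarrow> bool" where
  "convex_concentration I M Y K \<longleftrightarrow>
     (\<forall>L>0. \<forall>f. convex_fun I f \<and> lipschitz_fun L I f \<longrightarrow>
       (\<forall>t>0. \<forall>m. is_median M (\<lambda>\<omega>. f (Y \<omega>)) m \<longrightarrow>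
          measure M {\<omega> \<in> space M. \<bar>f (Y \<omega>) - m\<bar> \<ge> t} \<le> 2 * exp (- (t^2 / (K^2 * L^2)))))"

text \<open>The vectors \<open>Z 0, \<dots>, Z (N - 1)\<close> in \<open>\<real>\<^sup>n\<close> regarded as one vector in \<open>\<real>\<^sup>n\<^sup>N\<close>.\<close>

definition stack :: "nat \<Rightarrow> nat \<Rightarrow> (nat \<Rightarrow> nat \<Rightarrow> real) \<Rightarrow> nat \<times> nat \<Rightarrow> real" where
  "stack N n z = (\<lambda>(k, i) \<in> {..<N} \<times> {..<n}. z k i)"

text \<open>
  Dimension-free convex concentration of a random vector in \<open>\<real>\<^sup>n\<close> with law \<open>\<mu>\<close>: it is a property of
  the law, so the i.i.d. copies may be taken to be the coordinates of the product space. The lemma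
  \<open>convex_concentration_iid_copies\<close> below shows that any other i.i.d. copies, on an arbitrary
  probability space, give the same condition.
\<close>

definition dimension_free_convex_concentration ::
  "nat \<Rightarrow> (nat \<Rightarrow> real) measure \<Rightarrow> real \<Rightarrow> bool" where
  "dimension_free_convex_concentration n \<mu> K \<longleftrightarrow>
     (\<forall>N\<ge>1. convex_concentration ({..<N} \<times> {..<n}) (PiM {..<N} (\<lambda>_. \<mu>)) (stack N n) K)"

lemma lipschitz_fun_measurable:
  fixes f :: "('i::countable \<Rightarrow> real) \<Rightarrow> real"
  assumes "lipschitz_fun L I f" "finite I"
    and Y: "\<And>i. i \<in> I \<Longrightarrow> (\<lambda>\<omega>. Y \<omega> i) \<in> borel_measurable M"
    and ext: "\<And>\<omega>. Y \<omega> \<in> extensional I"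
  shows "(\<lambda>\<omega>. f (Y \<omega>)) \<in> borel_measurable M"
proof -
  define F where "F = (\<lambda>y. f (restrict y I))"
  have bound: "norm (F y - F x) \<le> L * L2_set (\<lambda>i. y i - x i) I" for x y
  proof -
    have "norm (F y - F x) \<le> L * L2_set (\<lambda>i. restrict y I i - restrict x I i) I"
      using assms(1) unfolding lipschitz_fun_def F_def real_norm_def
      by (meson restrict_extensional)
    also have "L2_set (\<lambda>i. restrict y I i - restrict x I i) I = L2_set (\<lambda>i. y i - x i) I"
      by (intro L2_set_cong) auto
    finally show ?thesis .
  qed
  have "isCont F x" for x
  proof -
    have "isCont (\<lambda>y::'i \<Rightarrow> real. L * L2_set (\<lambda>i. y i - x i) I) x"
    proof -
      have "isCont (\<lambda>y::'i \<Rightarrow> real. y i) x" for i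
        using continuous_on_product_coordinates[of i]
        by (metis continuous_on_eq_continuous_at open_UNIV UNIV_I)
      then show ?thesis
        unfolding L2_set_def by (intro continuous_intros) auto
    qed
    then have "((\<lambda>y. L * L2_set (\<lambda>i. y i - x i) I) \<longlongrightarrow> 0) (at x)"
      by (auto simp: isCont_def L2_set_def)
    then have "((\<lambda>y. F y - F x) \<longlongrightarrow> 0) (at x)"
      by (rule Lim_null_comparison[rotated]) (use bound in auto)
    then show ?thesis
      by (simp add: isCont_def LIM_zero_iff)
  qed
  then have "continuous_on UNIV F"
    by (simp add: continuous_at_imp_continuous_on)
  then have F: "F \<in> borel_measurable borel"
    by (rule borel_measurable_continuous_onI)
  have "(\<lambda>\<omega>. Y \<omega> i) \<in> borel_measurable M" for i
  proof (cases "i \<in> I")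
    case False
    then have "(\<lambda>\<omega>. Y \<omega> i) = (\<lambda>\<omega>. undefined)"
      using ext by (auto simp: extensional_def)
    then show ?thesis by simp
  qed (use Y in auto)
  then have "Y \<in> borel_measurable M"
    by (rule measurable_coordinatewise_then_product)
  from measurable_compose[OF this F] have "(\<lambda>\<omega>. F (Y \<omega>)) \<in> borel_measurable M" .
  moreover have "F (Y \<omega>) = f (Y \<omega>)" for \<omega>
    using ext by (simp add: F_def extensional_restrict)
  ultimately show ?thesis by simp
qed

lemma convex_concentration_transport:
  fixes Y :: "'b \<Rightarrow> 'i::countable \<Rightarrow> real"
  assumes T: "T \<in> M \<rightarrow>\<^sub>M M'" and law: "distr M M' T = M'" and "finite I"
    and Y: "\<And>i. i \<in> I \<Longrightarrow> (\<lambda>\<omega>. Y \<omega> i) \<in> borel_measurable M'"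
    and ext: "\<And>\<omega>. Y \<omega> \<in> extensional I"
  shows "convex_concentration I M (\<lambda>\<omega>. Y (T \<omega>)) K \<longleftrightarrow> convex_concentration I M' Y K"
proof -
  have push: "measure M {\<omega> \<in> space M. P (T \<omega>)} = measure M' {\<omega> \<in> space M'. P \<omega>}"
    if "{\<omega> \<in> space M'. P \<omega>} \<in> sets M'" for P
  proof -
    have "measure M' {\<omega> \<in> space M'. P \<omega>} = measure (distr M M' T) {\<omega> \<in> space M'. P \<omega>}"
      by (simp add: law)
    also have "\<dots> = measure M (T -` {\<omega> \<in> space M'. P \<omega>} \<inter> space M)"
      by (rule measure_distr[OF T that])
    also have "T -` {\<omega> \<in> space M'. P \<omega>} \<inter> space M = {\<omega> \<in> space M. P (T \<omega>)}"
      using measurable_space[OF T] by auto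
    finally show ?thesis by simp
  qed
  have "is_median M (\<lambda>\<omega>. f (Y (T \<omega>))) m \<longleftrightarrow> is_median M' (\<lambda>\<omega>. f (Y \<omega>)) m"
    "measure M {\<omega> \<in> space M. \<bar>f (Y (T \<omega>)) - m\<bar> \<ge> t} =
     measure M' {\<omega> \<in> space M'. \<bar>f (Y \<omega>) - m\<bar> \<ge> t}"
    if "lipschitz_fun L I f" for L f m t
  proof -
    have [measurable]: "(\<lambda>\<omega>. f (Y \<omega>)) \<in> borel_measurable M'"
      by (rule lipschitz_fun_measurable[OF that \<open>finite I\<close> Y ext])
    show "is_median M (\<lambda>\<omega>. f (Y (T \<omega>))) m \<longleftrightarrow> is_median M' (\<lambda>\<omega>. f (Y \<omega>)) m"
      unfolding is_median_def by (subst (1 2) push) simp_all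
    show "measure M {\<omega> \<in> space M. \<bar>f (Y (T \<omega>)) - m\<bar> \<ge> t} =
      measure M' {\<omega> \<in> space M'. \<bar>f (Y \<omega>) - m\<bar> \<ge> t}"
      by (rule push) simp
  qed
  then show ?thesis
    unfolding convex_concentration_def by (metis (no_types, lifting))
qed

lemma convex_concentration_iid_copies:
  fixes \<mu> :: "(nat \<Rightarrow> real) measure"
  assumes "prob_space M" and "N \<ge> 1"
    and coord: "\<And>i. i < n \<Longrightarrow> (\<lambda>x. x i) \<in> borel_measurable \<mu>"
    and Z: "\<And>k. k < N \<Longrightarrow> Z k \<in> M \<rightarrow>\<^sub>M \<mu>"
    and law: "\<And>k. k < N \<Longrightarrow> distr M \<mu> (Z k) = \<mu>"
    and indep: "prob_space.indep_vars M (\<lambda>_. \<mu>) Z {..<N}"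
  shows "convex_concentration ({..<N} \<times> {..<n}) M (\<lambda>\<omega>. stack N n (\<lambda>k. Z k \<omega>)) K \<longleftrightarrow>
    convex_concentration ({..<N} \<times> {..<n}) (PiM {..<N} (\<lambda>_. \<mu>)) (stack N n) K"
proof -
  interpret prob_space M by fact
  let ?T = "\<lambda>\<omega>. \<lambda>k\<in>{..<N}. Z k \<omega>"
  have "distr M (PiM {..<N} (\<lambda>_. \<mu>)) ?T = PiM {..<N} (\<lambda>k. distr M \<mu> (Z k))"
    using indep_vars_iff_distr_eq_PiM'[where I = "{..<N}" and M' = "\<lambda>_. \<mu>" and X = Z]
      Z indep \<open>N \<ge> 1\<close>
    by (auto simp: lessThan_empty_iff)
  also have "\<dots> = PiM {..<N} (\<lambda>_. \<mu>)"
    by (intro PiM_cong) (auto simp: law)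
  finally have T: "distr M (PiM {..<N} (\<lambda>_. \<mu>)) ?T = PiM {..<N} (\<lambda>_. \<mu>)" .
  have "?T \<in> M \<rightarrow>\<^sub>M PiM {..<N} (\<lambda>_. \<mu>)"
    using Z by (intro measurable_restrict) auto
  moreover have "(\<lambda>z. stack N n z j) \<in> borel_measurable (PiM {..<N} (\<lambda>_. \<mu>))"
    if jN: "j \<in> {..<N} \<times> {..<n}" for j
  proof -
    obtain k i where j: "j = (k, i)" "k < N" "i < n" using jN by auto
    have "(\<lambda>z. z k) \<in> PiM {..<N} (\<lambda>_. \<mu>) \<rightarrow>\<^sub>M \<mu>"
      using j by (intro measurable_component_singleton) auto
    from measurable_compose[OF this coord[OF j(3)]] show ?thesis
      using j by (simp add: stack_def)
  qed
  moreover have "stack N n z \<in> extensional ({..<N} \<times> {..<n})" for z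
    by (simp add: stack_def)
  ultimately have "convex_concentration ({..<N} \<times> {..<n}) M (\<lambda>\<omega>. stack N n (?T \<omega>)) K \<longleftrightarrow>
      convex_concentration ({..<N} \<times> {..<n}) (PiM {..<N} (\<lambda>_. \<mu>)) (stack N n) K"
    by (intro convex_concentration_transport[where T = ?T] T) simp_all
  moreover have "stack N n (?T \<omega>) = stack N n (\<lambda>k. Z k \<omega>)" for \<omega>
    by (auto simp: stack_def fun_eq_iff restrict_def)
  ultimately show ?thesis by simp
qed

end

theory Submission
  imports Defs
begin

text \<open>
  Let \<open>A\<close> be a convex compact subset of the cube and \<open>Z\<close> the squared Euclidean distance to \<open>A\<close>. Let
  \<open>Z\<^sub>j\<close> be the squared distance computed without the j-th coordinate. Then \<open>0 \<le> Z - Z\<^sub>j \<le> 4\<close>, and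
  convexity gives the self-bounding property \<open>\<Sum>\<^sub>j (Z - Z\<^sub>j)\<^sup>2 \<le> 16 Z\<close>. Approximate tensorization passes
  to product measures with the same constant, and its one-dimensional terms are controlled by
  \<open>Ent e\<^sup>g \<le> E (e\<^sup>g (e\<^sup>u - u - 1))\<close> with \<open>u = g\<^sub>j - g\<close>. Together they yield
  \<open>Ent e\<^bsup>lZ\<^esup> \<le> c l\<^sup>2 E (Z e\<^bsup>lZ\<^esup>)\<close> for \<open>l \<ge> -1\<close>, and the Herbst argument bounds
  \<open>E e\<^bsup>-Z\<^esup>\<close> and \<open>E e\<^bsup>Z/(2c)\<^esup>\<close> in terms of \<open>E Z\<close>. For the lower tail of \<open>f\<close> take
  \<open>A = {f \<le> m - t}\<close>: on \<open>{f \<ge> m}\<close>, which has probability at least 1/2, \<open>Z \<ge> (t/L)\<^sup>2\<close>, so \<open>E Z\<close> is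
  large and \<open>P(A) \<le> E e\<^bsup>-Z\<^esup>\<close> is small. For the upper tail take \<open>A = {f \<le> m}\<close>: now
  \<open>P(A) \<ge> 1/2\<close> forces \<open>E Z\<close> to be bounded, and \<open>Z\<close> has an exponential moment.
\<close>

section \<open>Entropy of bounded functions\<close>

definition real_ent :: "'a measure \<Rightarrow> ('a \<Rightarrow> real) \<Rightarrow> real" where
  "real_ent M F = (\<integral>x. F x * ln (F x) \<partial>M) - (\<integral>x. F x \<partial>M) * ln (\<integral>x. F x \<partial>M)"

text \<open>A positive lower bound and an upper bound together keep \<open>ln F\<close> bounded, so
  every integral in an entropy is finite. Exponentials of bounded functions qualify, and approximate
  tensorization is applied only to those.\<close>

definition pos_bounded :: "'a measure \<Rightarrow> ('a \<Rightarrow> real) \<Rightarrow> real \<Rightarrow> real \<Rightarrow> bool" where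
  "pos_bounded M F a b \<longleftrightarrow> F \<in> borel_measurable M \<and> 0 < a \<and> (\<forall>x\<in>space M. a \<le> F x \<and> F x \<le> b)"

lemma ln_abs_le:
  fixes a b u :: real
  assumes "0 < a" "a \<le> u" "u \<le> b"
  shows "\<bar>ln u\<bar> \<le> \<bar>ln a\<bar> + \<bar>ln b\<bar>"
proof -
  have "ln a \<le> ln u" "ln u \<le> ln b" using assms by (auto intro!: ln_mono)
  then show ?thesis by linarith
qed

context prob_space
begin

lemma integrable_bounded_on:
  fixes f :: "'a \<Rightarrow> real"
  assumes "f \<in> borel_measurable M" "\<And>x. x \<in> space M \<Longrightarrow> \<bar>f x\<bar> \<le> B"
  shows "integrable M f"
  using assms by (intro integrable_const_bound[where B = B]) auto

lemma integral_bounds: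
  fixes f :: "'a \<Rightarrow> real"
  assumes "f \<in> borel_measurable M" "\<And>x. x \<in> space M \<Longrightarrow> a \<le> f x \<and> f x \<le> b"
  shows "a \<le> (\<integral>x. f x \<partial>M)" "(\<integral>x. f x \<partial>M) \<le> b"
proof -
  have "integrable M f"
    by (rule integrable_bounded_on[where B = "\<bar>a\<bar> + \<bar>b\<bar>"]) (use assms in fastforce)+
  then show "a \<le> (\<integral>x. f x \<partial>M)" "(\<integral>x. f x \<partial>M) \<le> b"
    using assms(2) by (auto intro!: integral_ge_const integral_le_const)
qed

lemma pos_bounded_integrable:
  assumes "pos_bounded M F a b"
  shows "integrable M F" "integrable M (\<lambda>x. F x * ln (F x))"
    "0 < (\<integral>x. F x \<partial>M)" "a \<le> (\<integral>x. F x \<partial>M)" "(\<integral>x. F x \<partial>M) \<le> b"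
proof -
  have m[measurable]: "F \<in> borel_measurable M" and a: "0 < a"
    and b: "\<And>x. x \<in> space M \<Longrightarrow> a \<le> F x \<and> F x \<le> b"
    using assms by (auto simp: pos_bounded_def)
  show "integrable M F"
    by (rule integrable_bounded_on[where B = b]) (use a b in fastforce)+
  show "integrable M (\<lambda>x. F x * ln (F x))"
  proof (rule integrable_bounded_on[where B = "b * (\<bar>ln a\<bar> + \<bar>ln b\<bar>)"])
    fix x assume x: "x \<in> space M"
    show "\<bar>F x * ln (F x)\<bar> \<le> b * (\<bar>ln a\<bar> + \<bar>ln b\<bar>)"
      unfolding abs_mult using ln_abs_le[of a "F x" b] a b[OF x]
      by (intro mult_mono) auto
  qed simp
  show "a \<le> (\<integral>x. F x \<partial>M)" "(\<integral>x. F x \<partial>M) \<le> b"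
    using integral_bounds[OF m b] by auto
  then show "0 < (\<integral>x. F x \<partial>M)" using a by linarith
qed

lemma Ent_eq_real_ent:
  assumes "pos_bounded M F a b"
  shows "Ent M F = ennreal (real_ent M F)"
  using pos_bounded_integrable[OF assms] by (simp add: Ent_def real_ent_def)

text \<open>This is nonnegativity of the relative entropy of the density \<open>F / E F\<close> with
  respect to \<open>G / E G\<close>. It follows by integrating \<open>ln s <= s - 1\<close> at
  \<open>s = G x * E F / (E G * F x)\<close> against \<open>F\<close>.\<close>

lemma gibbs_variational:
  assumes F: "pos_bounded M F a b" and G: "pos_bounded M G a' b'"
  shows "(\<integral>x. F x * ln (G x) \<partial>M) - (\<integral>x. F x \<partial>M) * ln (\<integral>x. G x \<partial>M) \<le> real_ent M F"
proof -
  let ?f = "\<integral>x. F x \<partial>M" and ?g = "\<integral>x. G x \<partial>M"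
  note Fi = pos_bounded_integrable[OF F] and Gi = pos_bounded_integrable[OF G]
  have m[measurable]: "F \<in> borel_measurable M" "G \<in> borel_measurable M" and a: "0 < a" "0 < a'"
    and b: "\<And>x. x \<in> space M \<Longrightarrow> a \<le> F x \<and> F x \<le> b \<and> a' \<le> G x \<and> G x \<le> b'"
    using F G by (auto simp: pos_bounded_def)
  have FG: "integrable M (\<lambda>x. F x * ln (G x))"
  proof (rule integrable_bounded_on[where B = "b * (\<bar>ln a'\<bar> + \<bar>ln b'\<bar>)"])
    fix x assume x: "x \<in> space M"
    show "\<bar>F x * ln (G x)\<bar> \<le> b * (\<bar>ln a'\<bar> + \<bar>ln b'\<bar>)"
      unfolding abs_mult using ln_abs_le[of a' "G x" b'] a b[OF x]
      by (intro mult_mono) auto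
  qed simp
  have pt: "F x * ln (G x) - F x * ln (F x) \<le> F x * (ln ?g - ln ?f) + (G x * (?f / ?g) - F x)"
    if x: "x \<in> space M" for x
  proof -
    have pos: "F x > 0" "G x > 0" using a b[OF x] by auto
    have "ln (G x * ?f / (?g * F x)) \<le> G x * ?f / (?g * F x) - 1"
      using pos Fi Gi by (intro ln_le_minus_one) auto
    also have "ln (G x * ?f / (?g * F x)) = ln (G x) + ln ?f - ln ?g - ln (F x)"
      using pos Fi Gi by (simp add: ln_div ln_mult)
    finally have "F x * (ln (G x) + ln ?f - ln ?g - ln (F x)) \<le> F x * (G x * ?f / (?g * F x) - 1)"
      using pos by (intro mult_left_mono) auto
    also have "\<dots> = G x * (?f / ?g) - F x"
      using pos Fi Gi by (simp add: field_simps)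
    finally show ?thesis by (simp add: algebra_simps)
  qed
  have "(\<integral>x. F x * ln (G x) \<partial>M) - (\<integral>x. F x * ln (F x) \<partial>M)
      = (\<integral>x. F x * ln (G x) - F x * ln (F x) \<partial>M)"
    using FG Fi by simp
  also have "\<dots> \<le> (\<integral>x. F x * (ln ?g - ln ?f) + (G x * (?f / ?g) - F x) \<partial>M)"
    using FG Fi Gi pt by (intro integral_mono) auto
  also have "\<dots> = ?f * (ln ?g - ln ?f) + (?g * (?f / ?g) - ?f)"
    using Fi Gi by simp
  also have "\<dots> = ?f * (ln ?g - ln ?f)" using Gi by simp
  finally show ?thesis by (simp add: real_ent_def algebra_simps)
qed

lemma real_ent_nonneg:
  assumes F: "pos_bounded M F a b"
  shows "0 \<le> real_ent M F"
  using gibbs_variational[OF F, of "\<lambda>_. 1" 1 1] by (simp add: pos_bounded_def prob_space)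

text \<open>The integrand is the Bregman divergence of \<open>s * ln s\<close> between
  \<open>F x\<close> and \<open>c\<close>, whose mean is smallest at \<open>c = E F\<close>, where
  it equals the entropy. The freedom in \<open>c\<close> later allows the exponential of a function
  that ignores one coordinate.\<close>

lemma real_ent_le_shift:
  assumes F: "pos_bounded M F a b" and c: "c > 0"
  shows "real_ent M F \<le> (\<integral>x. F x * ln (F x) - F x * ln c - F x + c \<partial>M)"
proof -
  let ?f = "\<integral>x. F x \<partial>M"
  note Fi = pos_bounded_integrable[OF F]
  have "ln (c / ?f) \<le> c / ?f - 1" using Fi c by (intro ln_le_minus_one) auto
  then have "?f * (ln c - ln ?f) \<le> ?f * (c / ?f - 1)"
    using Fi c by (intro mult_left_mono) (auto simp: ln_div)
  also have "\<dots> = c - ?f" using Fi by (simp add: field_simps)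
  finally have "- (?f * ln ?f) \<le> - (?f * ln c) - ?f + c" by (simp add: algebra_simps)
  then show ?thesis using Fi by (simp add: real_ent_def prob_space)
qed

end

section \<open>Subadditivity of entropy over product measures\<close>

lemma real_ent_distr:
  assumes "T \<in> measurable M N" "F \<in> borel_measurable N"
  shows "real_ent (distr M N T) F = real_ent M (\<lambda>x. F (T x))"
  using assms by (simp add: real_ent_def integral_distr)

text \<open>
  The chain rule leaves the entropy of the marginal, which the variational formula bounds by the
  average entropy of the sections.
\<close>

lemma (in pair_prob_space) real_ent_pair_le:
  assumes F: "pos_bounded (M1 \<Otimes>\<^sub>M M2) F a b"
  shows "real_ent (M1 \<Otimes>\<^sub>M M2) F
    \<le> (\<integral>x. real_ent M2 (\<lambda>y. F (x, y)) \<partial>M1) + (\<integral>y. real_ent M1 (\<lambda>x. F (x, y)) \<partial>M2)"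
proof -
  have m[measurable]: "F \<in> borel_measurable (M1 \<Otimes>\<^sub>M M2)" and a: "0 < a"
    and b: "\<And>x y. x \<in> space M1 \<Longrightarrow> y \<in> space M2 \<Longrightarrow> a \<le> F (x, y) \<and> F (x, y) \<le> b"
    using F by (auto simp: pos_bounded_def space_pair_measure)
  let ?P = "M1 \<Otimes>\<^sub>M M2" and ?L = "\<bar>ln a\<bar> + \<bar>ln b\<bar>"
  define G where "G x = (\<integral>y. F (x, y) \<partial>M2)" for x
  have [measurable]: "G \<in> borel_measurable M1" unfolding G_def by measurable
  have Fx: "pos_bounded M2 (\<lambda>y. F (x, y)) a b" if "x \<in> space M1" for x
    using that a b by (auto simp: pos_bounded_def)
  have Fy: "pos_bounded M1 (\<lambda>x. F (x, y)) a b" if "y \<in> space M2" for y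
    using that a b by (auto simp: pos_bounded_def)
  have Gb: "a \<le> G x \<and> G x \<le> b" if "x \<in> space M1" for x
    using M2.pos_bounded_integrable[OF Fx[OF that]] by (simp add: G_def)
  have Gp: "pos_bounded M1 G a b" using Gb a by (auto simp: pos_bounded_def)
  have int1: "integrable M1 (\<lambda>x. u (G x))"
    if "u \<in> borel_measurable borel" "\<And>s. a \<le> s \<Longrightarrow> s \<le> b \<Longrightarrow> \<bar>u s\<bar> \<le> B" for u :: "real \<Rightarrow> real" and B
    using that Gb by (intro M1.integrable_bounded_on[where B = B]) auto
  have mb: "\<bar>u * ln v\<bar> \<le> b * ?L" if "a \<le> u" "u \<le> b" "a \<le> v" "v \<le> b" for u v
    unfolding abs_mult using ln_abs_le[of a v b] a that by (intro mult_mono) auto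
  have IF: "integrable ?P F"
    using b a by (intro integrable_bounded_on[where B = b]) (auto simp: space_pair_measure, fastforce)
  have IFF: "integrable ?P (\<lambda>z. F z * ln (F z))"
    using b by (intro integrable_bounded_on[where B = "b * ?L"]) (auto simp: space_pair_measure intro!: mb)
  have IFG: "integrable ?P (\<lambda>z. F z * ln (G (fst z)))"
    using b Gb by (intro integrable_bounded_on[where B = "b * ?L"])
      (auto simp: space_pair_measure intro!: mb)
  have EG: "(\<integral>x. G x \<partial>M1) = (\<integral>z. F z \<partial>?P)"
    unfolding G_def using integral_fst'[OF IF] by simp
  have IFx: "integrable M1 (\<lambda>x. \<integral>y. F (x,y) * ln (F (x,y)) \<partial>M2)"
    using integrable_fst'[OF IFF] by simp
  have IGG: "integrable M1 (\<lambda>x. G x * ln (G x))"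
    by (rule M1.pos_bounded_integrable[OF Gp])
  have "real_ent ?P F = ((\<integral>x. (\<integral>y. F (x,y) * ln (F (x,y)) \<partial>M2) \<partial>M1) - (\<integral>x. G x * ln (G x) \<partial>M1)) + real_ent M1 G"
    unfolding real_ent_def EG using integral_fst'[OF IFF] by simp
  also have "(\<integral>x. (\<integral>y. F (x,y) * ln (F (x,y)) \<partial>M2) \<partial>M1) - (\<integral>x. G x * ln (G x) \<partial>M1)
      = (\<integral>x. real_ent M2 (\<lambda>y. F (x, y)) \<partial>M1)"
    unfolding real_ent_def using IFx IGG by (simp add: G_def)
  also have "real_ent M1 G \<le> (\<integral>y. real_ent M1 (\<lambda>x. F (x, y)) \<partial>M2)"
  proof -
    \<comment> \<open>Since \<open>ln (G x)\<close> does not involve \<open>y\<close>, the factor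
      \<open>G\<close> can be unfolded back into \<open>F\<close>. After exchanging the integrals,
      each section \<open>F (_, y)\<close> is compared with the same test function \<open>G\<close>
      by \<open>gibbs_variational\<close>.\<close>
    have "(\<integral>x. G x * ln (G x) \<partial>M1) = (\<integral>x. (\<integral>y. F (x,y) * ln (G x) \<partial>M2) \<partial>M1)"
      unfolding G_def by simp
    also have "\<dots> = (\<integral>z. F z * ln (G (fst z)) \<partial>?P)"
      using integral_fst'[OF IFG] by simp
    also have "\<dots> = (\<integral>y. (\<integral>x. F (x,y) * ln (G x) \<partial>M1) \<partial>M2)"
      using IFG integral_snd[of "\<lambda>x y. F (x,y) * ln (G x)"] by (simp add: split_beta')
    finally have 1: "(\<integral>x. G x * ln (G x) \<partial>M1) = (\<integral>y. (\<integral>x. F (x,y) * ln (G x) \<partial>M1) \<partial>M2)" .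
    have 2: "(\<integral>x. G x \<partial>M1) = (\<integral>y. (\<integral>x. F (x,y) \<partial>M1) \<partial>M2)"
      unfolding EG using IF integral_snd[of "\<lambda>x y. F (x,y)"] by (simp add: split_beta')
    have I1: "integrable M2 (\<lambda>y. (\<integral>x. F (x,y) * ln (G x) \<partial>M1))"
      using IFG integrable_snd[of "\<lambda>x y. F (x,y) * ln (G x)"] by (simp add: split_beta')
    have I2: "integrable M2 (\<lambda>y. (\<integral>x. F (x,y) \<partial>M1))"
      using IF integrable_snd[of "\<lambda>x y. F (x,y)"] by (simp add: split_beta')
    have I3: "integrable M2 (\<lambda>y. (\<integral>x. F (x,y) * ln (F (x,y)) \<partial>M1))"
      using IFF integrable_snd[of "\<lambda>x y. F (x,y) * ln (F (x,y))"] by (simp add: split_beta')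
    have [measurable]: "(\<lambda>y. (\<integral>x. F (x,y) \<partial>M1)) \<in> borel_measurable M2"
      using I2 by simp
    have I4: "integrable M2 (\<lambda>y. (\<integral>x. F (x,y) \<partial>M1) * ln (\<integral>x. F (x,y) \<partial>M1))"
      using M1.pos_bounded_integrable[OF Fy]
      by (intro M2.integrable_bounded_on[where B = "b * ?L"]) (auto intro!: mb)
    have "real_ent M1 G = (\<integral>y. (\<integral>x. F (x,y) * ln (G x) \<partial>M1) - (\<integral>x. F (x,y) \<partial>M1) * ln (\<integral>x. G x \<partial>M1) \<partial>M2)"
      unfolding real_ent_def 1 using I1 I2 2 by simp
    also have "\<dots> \<le> (\<integral>y. real_ent M1 (\<lambda>x. F (x, y)) \<partial>M2)"
      unfolding real_ent_def using I1 I2 I3 I4 M1.gibbs_variational[OF Fy Gp]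
      by (intro integral_mono) (auto simp: real_ent_def)
    finally show ?thesis .
  qed
  finally show ?thesis by simp
qed

lemma real_ent_measurable:
  assumes "sigma_finite_measure N" "(\<lambda>(x, y). F x y) \<in> borel_measurable (M \<Otimes>\<^sub>M N)"
  shows "(\<lambda>x. real_ent N (F x)) \<in> borel_measurable M"
proof -
  interpret sigma_finite_measure N by fact
  note [measurable] = assms(2)
  show ?thesis unfolding real_ent_def by measurable
qed

text \<open>A non-integrable function has Bochner integral 0, so integrability need not be checked
  when passing to extended nonnegative values.\<close>

lemma integral_le_nn_integral:
  assumes "\<And>x. x \<in> space M \<Longrightarrow> 0 \<le> f x"
  shows "ennreal (\<integral>x. f x \<partial>M) \<le> (\<integral>\<^sup>+x. ennreal (f x) \<partial>M)"
proof (cases "integrable M f")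
  case True
  then show ?thesis using nn_integral_eq_integral[of M f] assms by simp
qed (simp add: not_integrable_integral_eq)

context
  fixes M :: "'i \<Rightarrow> 'a measure"
  assumes prob: "\<And>i. prob_space (M i)"
begin

interpretation product_sigma_finite M
  using prob by (intro product_sigma_finite.intro prob_space_imp_sigma_finite)

lemma measurable_coordinate_update:
  assumes "k \<in> I" "F \<in> measurable (PiM I M) N"
  shows "(\<lambda>(z, y). F (z(k := y))) \<in> measurable (PiM I M \<Otimes>\<^sub>M M k) N"
proof -
  have "(\<lambda>p. (fst p)(k := snd p)) \<in> PiM I M \<Otimes>\<^sub>M M k \<rightarrow>\<^sub>M PiM I M"
    by (rule measurable_fun_upd[where J = I]) (use assms in auto)
  from measurable_compose[OF this assms(2)] show ?thesis by (simp add: split_beta')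
qed

text \<open>Under a product measure the coordinate \<open>k\<close> is independent of the rest, so
  redrawing it from \<open>M k\<close> does not change the law. In the iterated integral the second
  update overwrites the first, and the first then integrates to mass 1.\<close>

lemma nn_integral_resample:
  assumes "finite I" "k \<in> I" and h: "h \<in> borel_measurable (PiM I M)"
  shows "(\<integral>\<^sup>+z. (\<integral>\<^sup>+y. h (z(k := y)) \<partial>M k) \<partial>PiM I M) = (\<integral>\<^sup>+z. h z \<partial>PiM I M)"
proof -
  interpret k: prob_space "M k" by (rule prob)
  define J where "J = I - {k}"
  have J: "finite J" "k \<notin> J" "I = insert k J" using assms by (auto simp: J_def)
  have 1: "(\<lambda>(z, y). h (z(k := y))) \<in> borel_measurable (PiM I M \<Otimes>\<^sub>M M k)"
    by (rule measurable_coordinate_update) fact+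
  have "(\<lambda>z. (\<integral>\<^sup>+y. h (z(k := y)) \<partial>M k)) \<in> borel_measurable (PiM I M)"
    using M.borel_measurable_nn_integral[OF 1] by simp
  then show ?thesis
    using h unfolding J(3) by (simp add: product_nn_integral_insert J(1,2) k.emeasure_space_1)
qed

text \<open>Induction on the index set: \<open>real_ent_pair_le\<close> splits off the factor
  \<open>M i\<close>, and the induction hypothesis is applied to every section of \<open>F\<close>
  at a fixed i-th coordinate. Values in \<open>ennreal\<close> allow the integrals to be exchanged
  by measurability alone.\<close>

lemma real_ent_PiM_le:
  assumes "finite I" "pos_bounded (PiM I M) F a b"
  shows "ennreal (real_ent (PiM I M) F) \<le>
    (\<Sum>k\<in>I. \<integral>\<^sup>+z. ennreal (real_ent (M k) (\<lambda>y. F (z(k := y)))) \<partial>PiM I M)"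
  using assms
proof (induction I arbitrary: F rule: finite_induct)
  case empty
  have "real_ent (PiM {} M) F = 0"
    by (simp add: real_ent_def PiM_empty lebesgue_integral_count_space_finite)
  then show ?case by simp
next
  case (insert i I F)
  let ?P = "PiM (insert i I) M" and ?PI = "PiM I M"
  have F[measurable]: "F \<in> borel_measurable ?P" and a: "0 < a"
    and b: "\<And>z. z \<in> space ?P \<Longrightarrow> a \<le> F z \<and> F z \<le> b"
    using insert.prems by (auto simp: pos_bounded_def)
  interpret PI: prob_space ?PI by (rule prob_space_PiM) (rule prob)
  interpret i: prob_space "M i" by (rule prob)
  interpret pr: pair_prob_space "M i" ?PI ..
  let ?T = "\<lambda>(y, x). x(i := y)"
  have T[measurable]: "?T \<in> M i \<Otimes>\<^sub>M ?PI \<rightarrow>\<^sub>M ?P"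
    unfolding split_beta' by (rule measurable_fun_upd[where J = I]) auto
  have upd: "x(i := y) \<in> space ?P" if "x \<in> space ?PI" "y \<in> space (M i)" for x y
    using measurable_space[OF T, of "(y, x)"] that by (simp add: space_pair_measure)
  have pb: "pos_bounded (M i \<Otimes>\<^sub>M ?PI) (\<lambda>p. F (?T p)) a b"
    using a b upd by (auto simp: pos_bounded_def space_pair_measure)
  have pbx: "pos_bounded (M i) (\<lambda>y. F (x(i := y))) a b" if "x \<in> space ?PI" for x
    using measurable_compose[OF measurable_Pair2'[OF that] pb[unfolded pos_bounded_def, THEN conjunct1]]
    using a b upd that by (auto simp: pos_bounded_def)
  have pby: "pos_bounded ?PI (\<lambda>x. F (x(i := y))) a b" if "y \<in> space (M i)" for y
    using measurable_compose[OF measurable_Pair1'[OF that] pb[unfolded pos_bounded_def, THEN conjunct1]]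
    using a b upd that by (auto simp: pos_bounded_def)
  define R where "R k z = ennreal (real_ent (M k) (\<lambda>y. F (z(k := y))))" for k z
  have R: "R k \<in> borel_measurable ?P" if "k \<in> insert i I" for k
    unfolding R_def using prob_space_imp_sigma_finite[OF prob, of k] measurable_coordinate_update[OF that F]
    by (intro measurable_compose[OF _ measurable_ennreal] real_ent_measurable) auto
  have "real_ent ?P F = real_ent (M i \<Otimes>\<^sub>M ?PI) (\<lambda>p. F (?T p))"
    using real_ent_distr[OF T F] distr_pair_PiM_eq_PiM[of I M i] prob by simp
  also have "\<dots> \<le> (\<integral>x. real_ent (M i) (\<lambda>y. F (x(i := y))) \<partial>?PI) + (\<integral>y. real_ent ?PI (\<lambda>x. F (x(i := y))) \<partial>M i)"
    using pr.real_ent_pair_le[OF pb] by simp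
  finally have "ennreal (real_ent ?P F) \<le> ennreal ((\<integral>x. real_ent (M i) (\<lambda>y. F (x(i := y))) \<partial>?PI) + (\<integral>y. real_ent ?PI (\<lambda>x. F (x(i := y))) \<partial>M i))"
    by (rule ennreal_leI)
  also have "\<dots> = ennreal (\<integral>x. real_ent (M i) (\<lambda>y. F (x(i := y))) \<partial>?PI) + ennreal (\<integral>y. real_ent ?PI (\<lambda>x. F (x(i := y))) \<partial>M i)"
    using i.real_ent_nonneg[OF pbx] PI.real_ent_nonneg[OF pby]
    by (intro ennreal_plus Bochner_Integration.integral_nonneg_AE) auto
  also have "\<dots> \<le> (\<integral>\<^sup>+x. ennreal (real_ent (M i) (\<lambda>y. F (x(i := y)))) \<partial>?PI) + (\<integral>\<^sup>+y. ennreal (real_ent ?PI (\<lambda>x. F (x(i := y)))) \<partial>M i)"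
    using i.real_ent_nonneg[OF pbx] PI.real_ent_nonneg[OF pby]
    by (intro add_mono integral_le_nn_integral)
  \<comment> \<open>\<open>R i\<close> ignores the i-th coordinate of its argument, so integrating
    over that coordinate as well changes nothing.\<close>
  also have "(\<integral>\<^sup>+x. ennreal (real_ent (M i) (\<lambda>y. F (x(i := y)))) \<partial>?PI) = (\<integral>\<^sup>+z. R i z \<partial>?P)"
    unfolding product_nn_integral_insert[OF insert.hyps R[OF insertI1]]
    by (simp add: R_def i.emeasure_space_1)
  also have "(\<integral>\<^sup>+y. ennreal (real_ent ?PI (\<lambda>x. F (x(i := y)))) \<partial>M i)
      \<le> (\<integral>\<^sup>+y. (\<Sum>k\<in>I. \<integral>\<^sup>+x. R k (x(i := y)) \<partial>?PI) \<partial>M i)"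
  proof (intro nn_integral_mono)
    fix y assume y: "y \<in> space (M i)"
    \<comment> \<open>Updates at distinct coordinates commute, so a section of the section of
      \<open>F\<close> is a section of \<open>F\<close> itself at \<open>x(i := y)\<close>.\<close>
    have eq: "(\<lambda>s. F (x(k := s, i := y))) = (\<lambda>s. F (x(i := y, k := s)))" if "k \<in> I" for k x
    proof -
      have "k \<noteq> i" using that insert.hyps by auto
      then show ?thesis by (simp add: fun_upd_twist[of k i])
    qed
    then show "ennreal (real_ent ?PI (\<lambda>x. F (x(i := y)))) \<le> (\<Sum>k\<in>I. \<integral>\<^sup>+x. R k (x(i := y)) \<partial>?PI)"
      using insert.IH[OF pby[OF y]] by (simp only: R_def eq cong: sum.cong)
  qed
  also have "\<dots> = (\<Sum>k\<in>I. \<integral>\<^sup>+y. (\<integral>\<^sup>+x. R k (x(i := y)) \<partial>?PI) \<partial>M i)"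
  proof (rule nn_integral_sum)
    fix k assume "k \<in> I"
    then have [measurable]: "R k \<in> borel_measurable ?P" using R by auto
    have "(\<lambda>(y, x). R k (x(i := y))) \<in> borel_measurable (M i \<Otimes>\<^sub>M ?PI)"
      using measurable_compose[OF T R[of k]] \<open>k \<in> I\<close>
      by (simp add: split_beta')
    from PI.borel_measurable_nn_integral[OF this]
    show "(\<lambda>y. \<integral>\<^sup>+x. R k (x(i := y)) \<partial>?PI) \<in> borel_measurable (M i)" by simp
  qed
  also have "\<dots> = (\<Sum>k\<in>I. \<integral>\<^sup>+z. R k z \<partial>?P)"
    using R by (intro sum.cong) (simp_all add: product_nn_integral_insert_rev insert.hyps)
  finally have "ennreal (real_ent ?P F) \<le> (\<integral>\<^sup>+z. R i z \<partial>?P) + (\<Sum>k\<in>I. \<integral>\<^sup>+z. R k z \<partial>?P)"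
    by (simp only: add_left_mono)
  then show ?case by (simp only: R_def sum.insert[OF insert.hyps])
qed

end

section \<open>Approximate tensorization as a modified logarithmic Sobolev inequality\<close>

lemma cube_update:
  assumes "i < n"
  shows "(\<lambda>(x, s). x(i := s)) \<in> cube {..<n} \<Otimes>\<^sub>M unit_seg \<rightarrow>\<^sub>M cube {..<n}"
proof -
  have "(\<lambda>p. (fst p)(i := snd p)) \<in> cube {..<n} \<Otimes>\<^sub>M unit_seg \<rightarrow>\<^sub>M cube {..<n}"
    by (rule measurable_fun_upd[where J = "{..<n}"]) (use assms in auto)
  then show ?thesis by (simp add: split_beta')
qed

lemma omit_measurable: "omit n i \<in> cube {..<n} \<rightarrow>\<^sub>M cube ({..<n} - {i})"
  unfolding omit_def[abs_def] by (rule measurable_restrict_subset) auto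

text \<open>The defining identity of the kernel concerns products of events only. Let
  \<open>N x\<close> be the law of \<open>x\<close> with its i-th coordinate redrawn from the
  kernel. Then \<open>\<mu> \<bind> N\<close> and \<open>\<mu>\<close> agree on boxes, hence
  coincide, and integrating \<open>h\<close> against both gives the claim.\<close>

lemma regular_cond_dist_disintegration:
  assumes "prob_space \<mu>" and sets[measurable_cong]: "sets \<mu> = sets (cube {..<n})" and i: "i < n"
    and rcd: "regular_cond_dist n \<mu> i \<kappa>" and h: "h \<in> borel_measurable (cube {..<n})"
  shows "(\<integral>\<^sup>+x. (\<integral>\<^sup>+s. h (x(i := s)) \<partial>\<kappa> (omit n i x)) \<partial>\<mu>) = (\<integral>\<^sup>+x. h x \<partial>\<mu>)"
proof -
  interpret prob_space \<mu> by fact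
  let ?Q = "cube {..<n}"
  have sp: "space \<mu> = space ?Q" using sets by (rule sets_eq_imp_space_eq)
  have \<kappa>[measurable]: "\<kappa> \<in> cube ({..<n} - {i}) \<rightarrow>\<^sub>M prob_algebra unit_seg"
    using rcd by (simp add: regular_cond_dist_def)
  have om[measurable]: "omit n i \<in> ?Q \<rightarrow>\<^sub>M cube ({..<n} - {i})" by (rule omit_measurable)
  note up = cube_update[OF i]
  have kom: "(\<lambda>x. \<kappa> (omit n i x)) \<in> \<mu> \<rightarrow>\<^sub>M subprob_algebra unit_seg"
    by (rule measurable_prob_algebraD) measurable
  have ksets: "sets (\<kappa> (omit n i x)) = sets unit_seg" if "x \<in> space \<mu>" for x
    using measurable_space[OF kom that] by (simp add: space_subprob_algebra)
  have upx: "(\<lambda>s. x(i := s)) \<in> unit_seg \<rightarrow>\<^sub>M ?Q" if "x \<in> space ?Q" for x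
    using measurable_compose[OF measurable_Pair1'[OF that] up] by simp
  define N where "N x = distr (\<kappa> (omit n i x)) ?Q (\<lambda>s. x(i := s))" for x
  have N: "N \<in> \<mu> \<rightarrow>\<^sub>M subprob_algebra ?Q"
    unfolding N_def using up by (intro measurable_distr2[OF _ kom]) (simp add: cong: measurable_cong_sets)
  have ne: "space \<mu> \<noteq> {}" by (rule not_empty)
  have "\<mu> \<bind> N = \<mu>"
  proof (rule measure_eqI_PiM_finite[where I = "{..<n}" and M = "\<lambda>_. unit_seg" and A = "\<lambda>_. space ?Q"])
    show "sets (\<mu> \<bind> N) = sets ?Q" by (rule sets_bind[OF _ ne]) (use N in \<open>auto simp: N_def\<close>)
    show "sets \<mu> = sets ?Q" by fact
    show "range (\<lambda>_::nat. space ?Q) \<subseteq> prod_algebra {..<n} (\<lambda>_. unit_seg)"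
      using prod_algebraI_finite[of "{..<n}" "\<lambda>_. space unit_seg" "\<lambda>_. unit_seg"] sets.top[of unit_seg]
      by (auto simp: space_PiM simp del: space_restrict_space space_restrict_space2)
    have "subprob_space (\<mu> \<bind> N)"
      by (rule subprob_space_bind[OF prob_space_imp_subprob_space[OF prob_space_axioms] N])
    from subprob_space.subprob_emeasure_le_1[OF this, of "space ?Q"]
    show "emeasure (\<mu> \<bind> N) (space ?Q) \<noteq> \<infinity>" for j :: nat
      by (auto simp: top_unique)
  next
    fix A :: "nat \<Rightarrow> real set" assume A: "\<And>j. j \<in> {..<n} \<Longrightarrow> A j \<in> sets unit_seg"
    let ?R = "PiE {..<n} A" and ?R' = "PiE ({..<n} - {i}) A"
    have R: "?R \<in> sets ?Q" "?R' \<in> sets (cube ({..<n} - {i}))"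
      using A by (auto intro!: sets_PiM_I_finite)
    have spext: "x \<in> extensional {..<n}" if "x \<in> space \<mu>" for x
      using that by (auto simp: sp space_PiM PiE_def)
    have Rs: "x(i := s) \<in> ?R \<longleftrightarrow> omit n i x \<in> ?R' \<and> s \<in> A i" if "x \<in> space \<mu>" for x s
      using spext[OF that] i unfolding PiE_iff omit_def by (auto simp: extensional_def)
    have "emeasure (\<mu> \<bind> N) ?R = (\<integral>\<^sup>+x. emeasure (N x) ?R \<partial>\<mu>)"
      by (rule emeasure_bind[OF ne N R(1)])
    also have "\<dots> = (\<integral>\<^sup>+x. emeasure (\<kappa> (omit n i x)) (A i) * indicator ?R' (omit n i x) \<partial>\<mu>)"
    proof (rule nn_integral_cong)
      fix x assume x: "x \<in> space \<mu>"
      have sk: "space (\<kappa> (omit n i x)) = space unit_seg" using ksets[OF x] by (rule sets_eq_imp_space_eq)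
      have "A i \<subseteq> space unit_seg" using A[of i] i sets.sets_into_space by blast
      then have "(\<lambda>s. x(i := s)) -` ?R \<inter> space (\<kappa> (omit n i x)) = (if omit n i x \<in> ?R' then A i else {})"
        unfolding sk using Rs[OF x] by auto
      then show "emeasure (N x) ?R = emeasure (\<kappa> (omit n i x)) (A i) * indicator ?R' (omit n i x)"
        unfolding N_def using upx[of x] x R(1) ksets[OF x]
        by (subst emeasure_distr) (auto simp: sp cong: measurable_cong_sets)
    qed
    also have "\<dots> = emeasure \<mu> {x \<in> space \<mu>. omit n i x \<in> ?R' \<and> x i \<in> A i}"
      using rcd R(2) A[of i] i by (simp add: regular_cond_dist_def)
    also have "{x \<in> space \<mu>. omit n i x \<in> ?R' \<and> x i \<in> A i} = ?R"
    proof -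
      have "x \<in> ?R \<Longrightarrow> x \<in> space \<mu>" for x using sets.sets_into_space[OF R(1)] by (auto simp: sp)
      moreover have "x \<in> ?R \<longleftrightarrow> omit n i x \<in> ?R' \<and> x i \<in> A i" if "x \<in> space \<mu>" for x
        using Rs[OF that, of "x i"] by simp
      ultimately show ?thesis by blast
    qed
    finally show "emeasure (\<mu> \<bind> N) ?R = emeasure \<mu> ?R" .
  qed auto
  then have "(\<integral>\<^sup>+x. h x \<partial>\<mu>) = (\<integral>\<^sup>+x. h x \<partial>(\<mu> \<bind> N))" by simp
  also have "\<dots> = (\<integral>\<^sup>+x. (\<integral>\<^sup>+y. h y \<partial>N x) \<partial>\<mu>)" by (rule nn_integral_bind[OF h N])
  also have "\<dots> = (\<integral>\<^sup>+x. (\<integral>\<^sup>+s. h (x(i := s)) \<partial>\<kappa> (omit n i x)) \<partial>\<mu>)"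
  proof (rule nn_integral_cong)
    fix x assume x: "x \<in> space \<mu>"
    show "(\<integral>\<^sup>+y. h y \<partial>N x) = (\<integral>\<^sup>+s. h (x(i := s)) \<partial>\<kappa> (omit n i x))"
      unfolding N_def using upx[of x] x ksets[OF x] h
      by (subst nn_integral_distr) (auto simp: sp cong: measurable_cong_sets)
  qed
  finally show ?thesis by simp
qed

text \<open>This is the integrand of \<open>real_ent_le_shift\<close> for exponentials: with
  \<open>F = exp g\<close> and \<open>c = exp g'\<close> it becomes
  \<open>exp g * exp_rem (g' - g)\<close>. It is also the second-order Taylor remainder used to
  differentiate the moment generating function.\<close>

definition exp_rem :: "real \<Rightarrow> real" where
  "exp_rem u = exp u - u - 1"

lemma exp_rem_nonneg: "0 \<le> exp_rem u"
  using exp_ge_add_one_self[of u] unfolding exp_rem_def by linarith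

text \<open>For \<open>u >= -1\<close>, multiplying \<open>1 - u <= exp (- u)\<close> by
  \<open>(1 + u) * exp u\<close> leaves the bound \<open>u^2 * exp u\<close>. For
  \<open>u < -1\<close>, \<open>exp u - 1\<close> is at most 0 and
  \<open>- u <= u^2\<close>.\<close>

lemma exp_rem_le: "exp_rem u \<le> u\<^sup>2 * max 1 (exp u)"
proof (cases "1 + u \<ge> 0")
  case True
  have "(1 - u) * (1 + u) \<le> exp (- u) * (1 + u)"
    using exp_ge_add_one_self[of "- u"] True by (intro mult_right_mono) auto
  then have "exp u * ((1 - u) * (1 + u)) \<le> exp u * (exp (- u) * (1 + u))"
    by (intro mult_left_mono) auto
  also have "\<dots> = 1 + u" by (simp add: exp_minus)
  finally have "exp_rem u \<le> u\<^sup>2 * exp u"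
    by (simp add: exp_rem_def algebra_simps power2_eq_square)
  also have "\<dots> \<le> u\<^sup>2 * max 1 (exp u)" by (intro mult_left_mono) auto
  finally show ?thesis .
next
  case False
  then have "exp u \<le> 1" by (subst exp_le_one_iff) linarith
  moreover have "- u \<le> u\<^sup>2"
    using False mult_left_mono[of 1 "- u" "- u"] by (simp add: power2_eq_square)
  ultimately have "exp_rem u \<le> u\<^sup>2 * 1" unfolding exp_rem_def by linarith
  also have "\<dots> \<le> u\<^sup>2 * max 1 (exp u)" by (intro mult_left_mono) auto
  finally show ?thesis .
qed

lemma exp_rem_measurable [measurable]: "exp_rem \<in> borel_measurable borel"
  unfolding exp_rem_def[abs_def] by measurable

lemma pos_bounded_exp:
  assumes "g \<in> borel_measurable M" "\<And>x. x \<in> space M \<Longrightarrow> \<bar>g x\<bar> \<le> B"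
  shows "pos_bounded M (\<lambda>x. exp (g x)) (exp (- B)) (exp B)"
  using assms by (auto simp: pos_bounded_def abs_le_iff minus_le_iff)

text \<open>As \<open>g' i\<close> ignores the i-th coordinate, \<open>exp (g' i x)\<close> is a
  constant for the i-th conditional law and may serve as \<open>c\<close> in
  \<open>real_ent_le_shift\<close>. The resulting integrals against the kernels are then absorbed
  into \<open>\<mu>\<close> by \<open>regular_cond_dist_disintegration\<close>.\<close>

lemma AT_real_ent_exp_le:
  assumes "prob_space \<mu>" and sets[measurable_cong]: "sets \<mu> = sets (cube {..<n})" and AT: "AT n C \<mu>"
    and g: "g \<in> borel_measurable \<mu>" "\<And>x. x \<in> space \<mu> \<Longrightarrow> \<bar>g x\<bar> \<le> B"
    and g': "\<And>i. i < n \<Longrightarrow> g' i \<in> borel_measurable \<mu>"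
      "\<And>i x s. i < n \<Longrightarrow> x \<in> space \<mu> \<Longrightarrow> s \<in> {-1..1} \<Longrightarrow> g' i (x(i := s)) = g' i x"
  shows "ennreal (real_ent \<mu> (\<lambda>x. exp (g x))) \<le>
    ennreal C * (\<Sum>i<n. \<integral>\<^sup>+x. ennreal (exp (g x) * exp_rem (g' i x - g x)) \<partial>\<mu>)"
proof -
  interpret prob_space \<mu> by fact
  let ?F = "\<lambda>x. exp (g x)"
  have sp: "space \<mu> = space (cube {..<n})" using sets by (rule sets_eq_imp_space_eq)
  define h where "h i x = ennreal (exp (g x) * exp_rem (g' i x - g x))" for i x
  have h: "h i \<in> borel_measurable (cube {..<n})" if "i < n" for i
    using g g'(1)[OF that] sets unfolding h_def[abs_def] by (simp cong: measurable_cong_sets)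
  have gm: "g \<in> borel_measurable (cube {..<n})"
    using g sets by (simp cong: measurable_cong_sets)
  obtain \<kappa> where K1: "\<forall>i<n. regular_cond_dist n \<mu> i (\<kappa> i)"
    and K2: "\<forall>f \<in> borel_measurable (cube {..<n}). (\<forall>x \<in> space (cube {..<n}). 0 \<le> f x) \<longrightarrow>
      Ent \<mu> f \<le> ennreal C * (\<integral>\<^sup>+x. (\<Sum>i<n. Ent (\<kappa> i (omit n i x)) (\<lambda>s. f (x(i := s)))) \<partial>\<mu>)"
    using AT unfolding AT_def by (elim exE conjE) (rule that)
  note \<kappa> = K1[rule_format]
  have k: "(\<lambda>x. \<kappa> i (omit n i x)) \<in> \<mu> \<rightarrow>\<^sub>M prob_algebra unit_seg" if "i < n" for i
  proof -
    have "\<kappa> i \<in> cube ({..<n} - {i}) \<rightarrow>\<^sub>M prob_algebra unit_seg"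
      using \<kappa>[OF that] unfolding regular_cond_dist_def by (rule conjunct1)
    from measurable_compose[OF omit_measurable this] show ?thesis
      by (subst measurable_cong_sets[OF sets refl])
  qed
  have loc: "Ent (\<kappa> i (omit n i x)) (\<lambda>s. ?F (x(i := s))) \<le> (\<integral>\<^sup>+s. h i (x(i := s)) \<partial>\<kappa> i (omit n i x))"
    if i: "i < n" and x: "x \<in> space \<mu>" for i x
  proof -
    let ?K = "\<kappa> i (omit n i x)"
    have K: "prob_space ?K" "sets ?K = sets unit_seg"
      using measurable_space[OF k[OF i] x] by (auto simp: space_prob_algebra)
    interpret K: prob_space ?K by fact
    have spK: "space ?K = {-1..1}" using sets_eq_imp_space_eq[OF K(2)] by simp
    have up: "(\<lambda>s. x(i := s)) \<in> unit_seg \<rightarrow>\<^sub>M cube {..<n}"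
      using measurable_compose[OF measurable_Pair1' cube_update[OF i]] x by (simp add: sp)
    have upx: "x(i := s) \<in> space \<mu>" if "s \<in> space ?K" for s
      using measurable_space[OF up, of s] that by (simp add: sp spK)
    have pb: "pos_bounded ?K (\<lambda>s. ?F (x(i := s))) (exp (- B)) (exp B)"
      using measurable_compose[OF up gm] K(2) g(2)[OF upx]
      by (intro pos_bounded_exp) (simp_all cong: measurable_cong_sets)
    have "real_ent ?K (\<lambda>s. ?F (x(i := s))) \<le>
        (\<integral>s. ?F (x(i := s)) * ln (?F (x(i := s))) - ?F (x(i := s)) * ln (exp (g' i x)) - ?F (x(i := s)) + exp (g' i x) \<partial>?K)"
      by (rule K.real_ent_le_shift[OF pb]) simp
    also have "\<dots> = (\<integral>s. ?F (x(i := s)) * exp_rem (g' i (x(i := s)) - g (x(i := s))) \<partial>?K)"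
      using g'(2)[OF i x] spK
      by (intro Bochner_Integration.integral_cong) (auto simp: exp_rem_def exp_diff algebra_simps)
    finally have "ennreal (real_ent ?K (\<lambda>s. ?F (x(i := s)))) \<le> ennreal \<dots>" by (rule ennreal_leI)
    also have "\<dots> \<le> (\<integral>\<^sup>+s. h i (x(i := s)) \<partial>?K)"
      unfolding h_def by (intro integral_le_nn_integral mult_nonneg_nonneg exp_rem_nonneg) auto
    finally show ?thesis using K.Ent_eq_real_ent[OF pb] by simp
  qed
  have "ennreal (real_ent \<mu> ?F) = Ent \<mu> ?F"
    using Ent_eq_real_ent[OF pos_bounded_exp[OF g]] by simp
  also have "\<dots> \<le> ennreal C * (\<integral>\<^sup>+x. (\<Sum>i<n. Ent (\<kappa> i (omit n i x)) (\<lambda>s. ?F (x(i := s)))) \<partial>\<mu>)"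
    by (rule K2[THEN bspec, THEN mp]) (use gm in auto)
  also have "\<dots> \<le> ennreal C * (\<integral>\<^sup>+x. (\<Sum>i<n. \<integral>\<^sup>+s. h i (x(i := s)) \<partial>\<kappa> i (omit n i x)) \<partial>\<mu>)"
    using loc by (intro mult_left_mono nn_integral_mono sum_mono) auto
  also have "(\<integral>\<^sup>+x. (\<Sum>i<n. \<integral>\<^sup>+s. h i (x(i := s)) \<partial>\<kappa> i (omit n i x)) \<partial>\<mu>)
      = (\<Sum>i<n. \<integral>\<^sup>+x. (\<integral>\<^sup>+s. h i (x(i := s)) \<partial>\<kappa> i (omit n i x)) \<partial>\<mu>)"
  proof (rule nn_integral_sum)
    fix i assume "i \<in> {..<n}"
    then have i: "i < n" by simp
    have "(\<lambda>(x, s). h i (x(i := s))) \<in> borel_measurable (\<mu> \<Otimes>\<^sub>M unit_seg)"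
      using measurable_compose[OF cube_update[OF i] h[OF i]] sets
      by (simp add: split_beta' cong: measurable_cong_sets)
    then show "(\<lambda>x. \<integral>\<^sup>+s. h i (x(i := s)) \<partial>\<kappa> i (omit n i x)) \<in> borel_measurable \<mu>"
      by (rule nn_integral_measurable_subprob_algebra2) (rule measurable_prob_algebraD[OF k[OF i]])
  qed
  also have "\<dots> = (\<Sum>i<n. \<integral>\<^sup>+x. h i x \<partial>\<mu>)"
    using \<kappa> h by (intro sum.cong refl regular_cond_dist_disintegration assms(1,2)) auto
  finally show ?thesis by (simp add: h_def)
qed

text \<open>Subadditivity of entropy reduces the product to single copies, where the one-copy bound
  applies with the other copies frozen; \<open>nn_integral_resample\<close> removes the inner
  integral. The constant \<open>C\<close> is the same for every number of copies, which is the
  source of dimension-freeness.\<close>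

lemma AT_real_ent_exp_PiM_le:
  assumes \<mu>: "prob_space \<mu>" "sets \<mu> = sets (cube {..<n})" "AT n C \<mu>" and "finite I"
    and g: "g \<in> borel_measurable (PiM I (\<lambda>_. \<mu>))" "\<And>z. z \<in> space (PiM I (\<lambda>_. \<mu>)) \<Longrightarrow> \<bar>g z\<bar> \<le> B"
    and g': "\<And>k i. k \<in> I \<Longrightarrow> i < n \<Longrightarrow> g' k i \<in> borel_measurable (PiM I (\<lambda>_. \<mu>))"
      "\<And>k i z s. k \<in> I \<Longrightarrow> i < n \<Longrightarrow> z \<in> space (PiM I (\<lambda>_. \<mu>)) \<Longrightarrow> s \<in> {-1..1} \<Longrightarrow>
        g' k i (z(k := (z k)(i := s))) = g' k i z"
  shows "ennreal (real_ent (PiM I (\<lambda>_. \<mu>)) (\<lambda>z. exp (g z))) \<le>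
    ennreal C * (\<integral>\<^sup>+z. (\<Sum>k\<in>I. \<Sum>i<n. ennreal (exp (g z) * exp_rem (g' k i z - g z))) \<partial>PiM I (\<lambda>_. \<mu>))"
proof -
  let ?P = "PiM I (\<lambda>_. \<mu>)"
  define h where "h k i z = ennreal (exp (g z) * exp_rem (g' k i z - g z))" for k i z
  have h: "h k i \<in> borel_measurable ?P" if "k \<in> I" "i < n" for k i
    using g g'(1)[OF that] unfolding h_def[abs_def] by simp
  have loc: "ennreal (real_ent \<mu> (\<lambda>y. exp (g (z(k := y))))) \<le> ennreal C * (\<Sum>i<n. \<integral>\<^sup>+y. h k i (z(k := y)) \<partial>\<mu>)"
    if k: "k \<in> I" and z: "z \<in> space ?P" for k z
  proof -
    have up: "(\<lambda>y. F (z(k := y))) \<in> borel_measurable \<mu>" if "F \<in> borel_measurable ?P" for F :: "_ \<Rightarrow> real"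
      using measurable_compose[OF measurable_Pair1'[OF z] measurable_coordinate_update[where M = "\<lambda>_. \<mu>", OF \<mu>(1) k that]]
      by simp
    have upz: "z(k := y) \<in> space ?P" if "y \<in> space \<mu>" for y
      using z that k by (auto simp: space_PiM PiE_iff extensional_def)
    show ?thesis
      unfolding h_def
    proof (rule AT_real_ent_exp_le[OF \<mu>, where B = B])
      show "g' k i (z(k := x(i := s))) = g' k i (z(k := x))"
        if "i < n" "x \<in> space \<mu>" "s \<in> {-1..1}" for i x s
        using g'(2)[OF k that(1) upz[OF that(2)] that(3)] by simp
    qed (use up upz k g g' in auto)
  qed
  have inner: "(\<lambda>z. \<integral>\<^sup>+y. h k i (z(k := y)) \<partial>\<mu>) \<in> borel_measurable ?P" if "k \<in> I" "i < n" for k i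
  proof -
    interpret prob_space \<mu> by fact
    show ?thesis
      using borel_measurable_nn_integral[OF measurable_coordinate_update[where M = "\<lambda>_. \<mu>", OF \<mu>(1) that(1) h[OF that]]]
      by simp
  qed
  have "ennreal (real_ent ?P (\<lambda>z. exp (g z))) \<le> (\<Sum>k\<in>I. \<integral>\<^sup>+z. ennreal (real_ent \<mu> (\<lambda>y. exp (g (z(k := y))))) \<partial>?P)"
    by (rule real_ent_PiM_le[OF \<mu>(1) \<open>finite I\<close> pos_bounded_exp[OF g]])
  also have "\<dots> \<le> (\<Sum>k\<in>I. \<integral>\<^sup>+z. ennreal C * (\<Sum>i<n. \<integral>\<^sup>+y. h k i (z(k := y)) \<partial>\<mu>) \<partial>?P)"
    using loc by (intro sum_mono nn_integral_mono) auto
  also have "\<dots> = (\<Sum>k\<in>I. ennreal C * (\<integral>\<^sup>+z. (\<Sum>i<n. h k i z) \<partial>?P))"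
  proof (rule sum.cong[OF refl])
    fix k assume k: "k \<in> I"
    have "(\<integral>\<^sup>+z. ennreal C * (\<Sum>i<n. \<integral>\<^sup>+y. h k i (z(k := y)) \<partial>\<mu>) \<partial>?P)
        = ennreal C * (\<integral>\<^sup>+z. (\<Sum>i<n. \<integral>\<^sup>+y. h k i (z(k := y)) \<partial>\<mu>) \<partial>?P)"
      using inner[OF k] by (intro nn_integral_cmult borel_measurable_sum) auto
    also have "(\<integral>\<^sup>+z. (\<Sum>i<n. \<integral>\<^sup>+y. h k i (z(k := y)) \<partial>\<mu>) \<partial>?P)
        = (\<Sum>i<n. \<integral>\<^sup>+z. (\<integral>\<^sup>+y. h k i (z(k := y)) \<partial>\<mu>) \<partial>?P)"
      using inner[OF k] by (intro nn_integral_sum) auto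
    also have "\<dots> = (\<Sum>i<n. \<integral>\<^sup>+z. h k i z \<partial>?P)"
      using nn_integral_resample[where M = "\<lambda>_. \<mu>", OF \<mu>(1) \<open>finite I\<close> k h[OF k]] by simp
    also have "\<dots> = (\<integral>\<^sup>+z. (\<Sum>i<n. h k i z) \<partial>?P)"
      using h[OF k] by (intro nn_integral_sum[symmetric]) auto
    finally show "(\<integral>\<^sup>+z. ennreal C * (\<Sum>i<n. \<integral>\<^sup>+y. h k i (z(k := y)) \<partial>\<mu>) \<partial>?P)
        = ennreal C * (\<integral>\<^sup>+z. (\<Sum>i<n. h k i z) \<partial>?P)" .
  qed
  also have "\<dots> = ennreal C * (\<integral>\<^sup>+z. (\<Sum>k\<in>I. \<Sum>i<n. h k i z) \<partial>?P)"
    unfolding sum_distrib_left[symmetric] using h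
    by (subst nn_integral_sum) (auto intro!: borel_measurable_sum)
  finally show ?thesis by (simp add: h_def)
qed

section \<open>The Herbst argument\<close>

context prob_space
begin

text \<open>The numerator of the difference quotient, minus its linear term, is the mean of
  \<open>exp (l * Z) * exp_rem (h * Z)\<close>. For bounded \<open>Z\<close> this is of order
  \<open>h^2\<close>.\<close>

lemma mgf_has_derivative:
  assumes Z[measurable]: "Z \<in> borel_measurable M" and B: "\<And>x. x \<in> space M \<Longrightarrow> \<bar>Z x\<bar> \<le> B"
  shows "((\<lambda>l. \<integral>x. exp (l * Z x) \<partial>M) has_real_derivative (\<integral>x. Z x * exp (l * Z x) \<partial>M)) (at l)"
proof -
  let ?H = "\<lambda>l. \<integral>x. exp (l * Z x) \<partial>M" and ?D = "\<integral>x. Z x * exp (l * Z x) \<partial>M"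
  have lZ: "\<bar>l * Z x\<bar> \<le> \<bar>l\<bar> * B" if "x \<in> space M" for x l
    using B[OF that] by (simp add: abs_mult mult_left_mono)
  have e: "exp (l * Z x) \<le> exp (\<bar>l\<bar> * B)" if "x \<in> space M" for x l
    using lZ[OF that, of l] by simp
  have I1: "integrable M (\<lambda>x. exp (l * Z x))" for l
    using e by (intro integrable_bounded_on[where B = "exp (\<bar>l\<bar> * B)"]) auto
  have I2: "integrable M (\<lambda>x. Z x * exp (l * Z x))"
  proof (rule integrable_bounded_on[where B = "B * exp (\<bar>l\<bar> * B)"])
    fix x assume x: "x \<in> space M"
    show "\<bar>Z x * exp (l * Z x)\<bar> \<le> B * exp (\<bar>l\<bar> * B)"
      unfolding abs_mult using e[OF x, of l] B[OF x] by (intro mult_mono) auto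
  qed simp
  \<comment> \<open>The first factor bounds \<open>exp (l * Z)\<close>. The second comes from
    \<open>exp_rem_le\<close> at \<open>h * Z\<close>, whose modulus is at most \<open>B\<close>
    because \<open>\<bar>h\<bar> < 1\<close>.\<close>
  define E where "E = exp (\<bar>l\<bar> * B) * (B\<^sup>2 * exp B)"
  have est: "\<bar>(?H (l + h) - ?H l) / h - ?D\<bar> \<le> E * \<bar>h\<bar>" if h: "h \<noteq> 0" "\<bar>h\<bar> < 1" for h
  proof -
    have "\<bar>?H (l + h) - ?H l - h * ?D\<bar> = \<bar>\<integral>x. exp ((l + h) * Z x) - exp (l * Z x) - h * (Z x * exp (l * Z x)) \<partial>M\<bar>"
      using I1 I2 by simp
    also have "\<dots> \<le> (\<integral>x. \<bar>exp ((l + h) * Z x) - exp (l * Z x) - h * (Z x * exp (l * Z x))\<bar> \<partial>M)"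
      by (rule integral_abs_bound)
    also have "\<dots> \<le> (\<integral>x. E * h\<^sup>2 \<partial>M)"
    proof (rule integral_mono)
      fix x assume x: "x \<in> space M"
      have hz: "\<bar>h * Z x\<bar> \<le> B"
        using h B[OF x] mult_mono[of "\<bar>h\<bar>" 1 "\<bar>Z x\<bar>" B] by (simp add: abs_mult)
      have eq: "exp ((l + h) * Z x) - exp (l * Z x) - h * (Z x * exp (l * Z x)) = exp (l * Z x) * exp_rem (h * Z x)"
        by (simp add: exp_rem_def exp_add algebra_simps)
      have "exp_rem (h * Z x) \<le> h\<^sup>2 * (B\<^sup>2 * exp B)"
      proof -
        have "exp_rem (h * Z x) \<le> (h * Z x)\<^sup>2 * max 1 (exp (h * Z x))" by (rule exp_rem_le)
        also have "\<dots> \<le> (h\<^sup>2 * B\<^sup>2) * exp B"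
          using hz B[OF x] power_mono[of "\<bar>Z x\<bar>" B 2]
          by (intro mult_mono) (auto simp: power_mult_distrib intro!: mult_left_mono)
        finally show ?thesis by (simp add: mult.assoc)
      qed
      moreover have "exp (l * Z x) * (h\<^sup>2 * (B\<^sup>2 * exp B)) \<le> E * h\<^sup>2"
        unfolding E_def using e[OF x, of l] mult_right_mono[of "exp (l * Z x)" "exp (\<bar>l\<bar> * B)" "h\<^sup>2 * (B\<^sup>2 * exp B)"]
        by (simp add: mult_ac)
      ultimately have "exp (l * Z x) * exp_rem (h * Z x) \<le> E * h\<^sup>2"
        by (meson exp_ge_zero mult_left_mono order_trans)
      then show "\<bar>exp ((l + h) * Z x) - exp (l * Z x) - h * (Z x * exp (l * Z x))\<bar> \<le> E * h\<^sup>2"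
        unfolding eq using exp_rem_nonneg[of "h * Z x"] by simp
    qed (use I1 I2 in auto)
    also have "\<dots> = E * h\<^sup>2" by (simp add: prob_space)
    finally have "\<bar>?H (l + h) - ?H l - h * ?D\<bar> / \<bar>h\<bar> \<le> E * h\<^sup>2 / \<bar>h\<bar>"
      by (rule divide_right_mono) simp
    also have "E * h\<^sup>2 / \<bar>h\<bar> = E * \<bar>h\<bar>"
      using h by (cases "h > 0") (auto simp: power2_eq_square)
    also have "\<bar>?H (l + h) - ?H l - h * ?D\<bar> / \<bar>h\<bar> = \<bar>(?H (l + h) - ?H l) / h - ?D\<bar>"
      using h by (simp flip: abs_divide add: diff_divide_distrib)
    finally show ?thesis .
  qed
  have "((\<lambda>h. (?H (l + h) - ?H l) / h - ?D) \<longlongrightarrow> 0) (at 0)"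
  proof (rule Lim_null_comparison)
    show "eventually (\<lambda>h. norm ((?H (l + h) - ?H l) / h - ?D) \<le> E * \<bar>h\<bar>) (at 0)"
      using est unfolding eventually_at real_norm_def by (intro exI[of _ 1]) auto
    show "((\<lambda>h. E * \<bar>h\<bar>) \<longlongrightarrow> 0) (at 0)"
      by (auto intro!: tendsto_eq_intros)
  qed
  then show ?thesis by (simp add: DERIV_def LIM_zero_iff)
qed

text \<open>With \<open>H l = E exp (l * Z)\<close>, the entropy \<open>l * H' - H * ln H\<close>
  is, after division by \<open>H * l^2\<close>, the derivative of \<open>ln H / l\<close>. The
  hypothesis thus says that \<open>R\<close> has nonpositive derivative away from 0. Comparing its
  limit at 0 with \<open>l = -1\<close>, the least admissible value, and with
  \<open>l = 1 / (2 * c)\<close> gives the two bounds.\<close>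

lemma herbst:
  assumes Z[measurable]: "Z \<in> borel_measurable M" and B: "\<And>x. x \<in> space M \<Longrightarrow> \<bar>Z x\<bar> \<le> B"
    and c: "c > 0"
    and ent: "\<And>l. l \<ge> -1 \<Longrightarrow> real_ent M (\<lambda>x. exp (l * Z x)) \<le> c * l\<^sup>2 * (\<integral>x. Z x * exp (l * Z x) \<partial>M)"
  shows "(\<integral>x. exp (- Z x) \<partial>M) \<le> exp (- (\<integral>x. Z x \<partial>M) / (1 + c))"
    and "(\<integral>x. exp (Z x / (2 * c)) \<partial>M) \<le> exp ((\<integral>x. Z x \<partial>M) / c)"
proof -
  define H where "H l = (\<integral>x. exp (l * Z x) \<partial>M)" for l
  define D where "D l = (\<integral>x. Z x * exp (l * Z x) \<partial>M)" for l
  define R where "R l = ln (H l) / l - c * ln (H l)" for l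
  have lZ: "\<bar>l * Z x\<bar> \<le> \<bar>l\<bar> * B" if "x \<in> space M" for x l
    using B[OF that] by (simp add: abs_mult mult_left_mono)
  have pb: "pos_bounded M (\<lambda>x. exp (l * Z x)) (exp (- (\<bar>l\<bar> * B))) (exp (\<bar>l\<bar> * B))" for l
    using lZ by (intro pos_bounded_exp) auto
  have Hpos: "H l > 0" for l
    unfolding H_def by (rule pos_bounded_integrable(3)[OF pb])
  have le: "H l \<le> exp y" if "ln (H l) \<le> y" for l y
    by (metis Hpos exp_le_cancel_iff exp_ln that)
  have H0: "H 0 = 1" by (simp add: H_def prob_space)
  have dH: "(H has_real_derivative D l) (at l)" for l
    unfolding H_def[abs_def] D_def by (rule mgf_has_derivative[OF Z B])
  have dL: "((\<lambda>l. ln (H l)) has_real_derivative D l / H l) (at l)" for l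
    using DERIV_chain2[OF DERIV_ln[OF Hpos] dH, of l] by (simp add: divide_inverse mult.commute)
  have key: "l * D l - H l * ln (H l) \<le> c * l\<^sup>2 * D l" if "l \<ge> -1" for l
    using ent[OF that] by (simp add: real_ent_def H_def D_def mult_ac)
  have dR: "\<exists>y. (R has_real_derivative y) (at l) \<and> y \<le> 0" if l: "l \<ge> -1" "l \<noteq> 0" for l
  proof (intro exI conjI)
    show "(R has_real_derivative ((D l / H l) * l - ln (H l)) / l\<^sup>2 - c * (D l / H l)) (at l)"
      unfolding R_def[abs_def] using l
      by (intro DERIV_diff DERIV_cmult dL)
        (use DERIV_divide[OF dL DERIV_ident, of l] in \<open>simp add: power2_eq_square\<close>)
    have "(l * D l - H l * ln (H l)) / (H l * l\<^sup>2) \<le> c * l\<^sup>2 * D l / (H l * l\<^sup>2)"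
      using key[OF l(1)] Hpos[of l] by (intro divide_right_mono) auto
    then show "((D l / H l) * l - ln (H l)) / l\<^sup>2 - c * (D l / H l) \<le> 0"
      using Hpos[of l] l by (simp add: field_simps)
  qed
  \<comment> \<open>On each side of 0, \<open>R\<close> is nonincreasing, and it tends to \<open>E Z\<close> at 0.\<close>
  have anti: "R b \<le> R a" if "-1 \<le> a" "a \<le> b" "0 < a \<or> b < 0" for a b
    using that by (intro DERIV_nonpos_imp_nonincreasing[of a b R] dR) auto
  have lim: "(R \<longlongrightarrow> D 0) (at 0)"
  proof -
    \<comment> \<open>As \<open>ln (H 0) = 0\<close>, this is the difference quotient of
      \<open>ln H\<close> at 0, with limit \<open>D 0 / H 0 = D 0\<close>.\<close>
    have "((\<lambda>l. ln (H l) / l) \<longlongrightarrow> D 0) (at 0)"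
      using dL[of 0] by (simp add: DERIV_def H0)
    from tendsto_diff[OF this, of "\<lambda>l. c * ln (H l)" 0] show ?thesis
      unfolding R_def[abs_def] using DERIV_isCont[OF dL[of 0]]
      by (simp add: isCont_def H0 tendsto_mult_right_zero)
  qed
  have D0: "D 0 = (\<integral>x. Z x \<partial>M)" by (simp add: D_def)
  have "D 0 \<le> R (-1)"
  proof (rule tendsto_upperbound)
    show "(R \<longlongrightarrow> D 0) (at_left 0)" using lim by (rule filterlim_mono) (auto simp: at_le)
    show "eventually (\<lambda>l. R l \<le> R (-1)) (at_left 0)"
      using anti[of "-1"] by (subst eventually_at_left[of "-1"]) (auto intro!: exI[of _ "-1"])
  qed simp
  \<comment> \<open>Here \<open>R (-1) = - (1 + c) * ln (H (-1))\<close>.\<close>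
  then have "ln (H (-1)) \<le> - D 0 / (1 + c)"
    using c by (simp add: R_def field_simps)
  then show "(\<integral>x. exp (- Z x) \<partial>M) \<le> exp (- (\<integral>x. Z x \<partial>M) / (1 + c))"
    using le[of "-1"] by (simp add: H_def D0)
  have "R (1 / (2 * c)) \<le> D 0"
  proof (rule tendsto_lowerbound)
    show "(R \<longlongrightarrow> D 0) (at_right 0)" using lim by (rule filterlim_mono) (auto simp: at_le)
    show "eventually (\<lambda>l. R (1 / (2 * c)) \<le> R l) (at_right 0)"
      using anti[of _ "1 / (2 * c)"] c
      by (subst eventually_at_right[of _ "1 / (2 * c)"]) (auto intro!: exI[of _ "1 / (2 * c)"])
  qed simp
  \<comment> \<open>At this point \<open>1 / l - c = c\<close>, so \<open>R\<close> is
    \<open>c\<close> times \<open>ln H\<close>.\<close>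
  then have "ln (H (1 / (2 * c))) \<le> D 0 / c"
    using c by (simp add: R_def field_simps)
  then show "(\<integral>x. exp (Z x / (2 * c)) \<partial>M) \<le> exp ((\<integral>x. Z x \<partial>M) / c)"
    using le[of "1 / (2 * c)"] by (simp add: H_def D0)
qed

end

section \<open>Squared distance to a convex subset of the cube\<close>

text \<open>The coordinate set \<open>J\<close> is an argument so that the distance computed without
  one coordinate is again a value of the same function.\<close>

definition sqdist :: "('i \<Rightarrow> real) set \<Rightarrow> 'i set \<Rightarrow> ('i \<Rightarrow> real) \<Rightarrow> real" where
  "sqdist A J x = (INF a\<in>A. \<Sum>j\<in>J. (x j - a j)\<^sup>2)"

lemma sqdist_bdd_below: "bdd_below ((\<lambda>a. \<Sum>j\<in>J. (x j - a j)\<^sup>2) ` A)"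
  for x :: "'i \<Rightarrow> real"
  by (intro bdd_belowI[of _ 0]) (auto intro: sum_nonneg)

lemma sqdist_le: "a \<in> A \<Longrightarrow> sqdist A J x \<le> (\<Sum>j\<in>J. (x j - a j)\<^sup>2)"
  unfolding sqdist_def by (rule cINF_lower[OF sqdist_bdd_below])

lemma sqdist_ge: "A \<noteq> {} \<Longrightarrow> (\<And>a. a \<in> A \<Longrightarrow> c \<le> (\<Sum>j\<in>J. (x j - a j)\<^sup>2)) \<Longrightarrow> c \<le> sqdist A J x"
  unfolding sqdist_def by (rule cINF_greatest)

lemma sqdist_nonneg: "A \<noteq> {} \<Longrightarrow> 0 \<le> sqdist A J x"
  by (intro sqdist_ge sum_nonneg) auto

lemma sqdist_mem:
  assumes "x \<in> A"
  shows "sqdist A J x = 0"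
  using sqdist_le[OF assms, of J x] sqdist_nonneg[of A J x] assms by fastforce

lemma sqdist_cong: "(\<And>j. j \<in> J \<Longrightarrow> x j = y j) \<Longrightarrow> sqdist A J x = sqdist A J y"
  unfolding sqdist_def by simp

text \<open>\<open>A\<close> may be uncountable, but an infimum of continuous functions is upper
  semicontinuous: its strict sublevel sets are unions of open sets.\<close>

lemma sqdist_measurable [measurable]:
  fixes A :: "('i::countable \<Rightarrow> real) set"
  assumes "A \<noteq> {}"
  shows "sqdist A J \<in> borel_measurable borel"
proof (rule borel_measurableI_less)
  fix c :: real
  have "{x \<in> space borel. sqdist A J x < c} = (\<Union>a\<in>A. {x. (\<Sum>j\<in>J. (x j - a j)\<^sup>2) < c})"
    unfolding sqdist_def using assms by (auto simp: cINF_less_iff[OF _ sqdist_bdd_below])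
  also have "open \<dots>"
    by (intro open_UN ballI open_Collect_less continuous_intros continuous_on_product_coordinates)
  finally show "{x \<in> space borel. sqdist A J x < c} \<in> sets borel" by (metis borel_open)
qed

section \<open>Compact convex sublevel sets in the cube\<close>

lemma compact_PiE_interval: "compact (PiE I (\<lambda>_. {a..b::real}))"
proof -
  \<comment> \<open>Off \<open>I\<close> the only value is \<open>undefined\<close>, so the set is a
    product of compact sets over all indices and Tychonoff's theorem applies.\<close>
  have "PiE I (\<lambda>_. {a..b}) = PiE UNIV (\<lambda>i. if i \<in> I then {a..b} else {undefined})"
    by (auto simp: PiE_iff extensional_def split: if_splits)
  moreover have "compactin (product_topology (\<lambda>_. euclidean) UNIV) (PiE UNIV (\<lambda>i. if i \<in> I then {a..b} else {undefined :: real}))"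
    by (subst compactin_PiE) (auto simp: compactin_euclidean_iff)
  ultimately show ?thesis
    by (simp add: euclidean_product_topology compactin_euclidean_iff)
qed

text \<open>The Lipschitz bound controls \<open>f\<close> on \<open>extensional I\<close> only.
  Composing with the restriction gives a continuous function on the whole space.\<close>

lemma lipschitz_fun_continuous:
  fixes f :: "('i::countable \<Rightarrow> real) \<Rightarrow> real"
  assumes "lipschitz_fun L I f" "finite I"
  shows "continuous_on UNIV (\<lambda>y. f (restrict y I))"
proof -
  have "isCont (\<lambda>y. f (restrict y I)) x" for x :: "'i \<Rightarrow> real"
  proof -
  have bound: "norm (f (restrict y I) - f (restrict x I)) \<le> L * L2_set (\<lambda>i. y i - x i) I" for y
  proof -
    have "norm (f (restrict y I) - f (restrict x I)) \<le> L * L2_set (\<lambda>i. restrict y I i - restrict x I i) I"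
      using assms(1) unfolding lipschitz_fun_def real_norm_def by (meson restrict_extensional)
    also have "L2_set (\<lambda>i. restrict y I i - restrict x I i) I = L2_set (\<lambda>i. y i - x i) I"
      by (intro L2_set_cong) auto
    finally show ?thesis .
  qed
  have "continuous_on UNIV (\<lambda>y::'i \<Rightarrow> real. L * L2_set (\<lambda>i. y i - x i) I)"
    unfolding L2_set_def by (intro continuous_intros continuous_on_product_coordinates)
  then have "isCont (\<lambda>y::'i \<Rightarrow> real. L * L2_set (\<lambda>i. y i - x i) I) x"
    by (simp add: continuous_on_eq_continuous_at)
  then have "((\<lambda>y. L * L2_set (\<lambda>i. y i - x i) I) \<longlongrightarrow> 0) (at x)"
    by (auto simp: isCont_def L2_set_def)
  then have "((\<lambda>y. f (restrict y I) - f (restrict x I)) \<longlongrightarrow> 0) (at x)"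
    by (rule Lim_null_comparison[rotated]) (use bound in auto)
  then show ?thesis
    by (simp add: isCont_def LIM_zero_iff)
  qed
  then show ?thesis by (simp add: continuous_at_imp_continuous_on)
qed

definition cube_sublevel :: "'i set \<Rightarrow> (('i \<Rightarrow> real) \<Rightarrow> real) \<Rightarrow> real \<Rightarrow> ('i \<Rightarrow> real) set" where
  "cube_sublevel I f \<theta> = {x \<in> PiE I (\<lambda>_. {-1..1}). f x \<le> \<theta>}"

lemma cube_sublevel_compact:
  fixes f :: "('i::countable \<Rightarrow> real) \<Rightarrow> real"
  assumes "lipschitz_fun L I f" "finite I"
  shows "compact (cube_sublevel I f \<theta>)"
proof -
  have "cube_sublevel I f \<theta> = PiE I (\<lambda>_. {-1..1}) \<inter> {y. f (restrict y I) \<le> \<theta>}"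
    by (auto simp: cube_sublevel_def PiE_restrict)
  moreover have "closed {y. f (restrict y I) \<le> \<theta>}"
    by (intro closed_Collect_le lipschitz_fun_continuous[OF assms] continuous_on_const)
  ultimately show ?thesis
    using compact_PiE_interval by (metis compact_Int_closed)
qed

lemma cube_sublevel_convex:
  assumes "convex_fun I f" and a: "a \<in> cube_sublevel I f \<theta>" and b: "b \<in> cube_sublevel I f \<theta>"
    and t: "0 \<le> t" "t \<le> 1"
  shows "(\<lambda>i\<in>I. (1 - t) * a i + t * b i) \<in> cube_sublevel I f \<theta>"
proof -
  have ab: "a i \<in> {-1..1}" "b i \<in> {-1..1}" if "i \<in> I" for i
    using a b that by (auto simp: cube_sublevel_def PiE_iff)
  have "(1 - t) * a i + t * b i \<in> {-1..1}" if "i \<in> I" for i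
    using convexD_alt[OF convex_closed_interval(1)[of "-1::real" 1] ab[OF that] t] by simp
  moreover have "f (\<lambda>i\<in>I. (1 - t) * a i + t * b i) \<le> (1 - t) * f a + t * f b"
    using assms by (auto simp: convex_fun_def cube_sublevel_def PiE_def)
  moreover have "(1 - t) * f a + t * f b \<le> (1 - t) * \<theta> + t * \<theta>"
    using a b t by (intro add_mono mult_left_mono) (auto simp: cube_sublevel_def)
  ultimately show ?thesis by (auto simp: cube_sublevel_def algebra_simps)
qed

section \<open>Nearest points and the self-bounding property\<close>

locale convex_in_cube =
  fixes I :: "'i set" and A :: "('i \<Rightarrow> real) set"
  assumes finite_I: "finite I" and compact_A: "compact A" and nonempty: "A \<noteq> {}"
    and in_cube: "A \<subseteq> PiE I (\<lambda>_. {-1..1})"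
    and convex_A: "\<And>a b t. a \<in> A \<Longrightarrow> b \<in> A \<Longrightarrow> 0 \<le> t \<Longrightarrow> t \<le> 1 \<Longrightarrow> (\<lambda>i\<in>I. (1 - t) * a i + t * b i) \<in> A"
begin

text \<open>
  \<open>sqdist A (I - {j}) x\<close> is the minimum of \<open>sqdist A I\<close> over the j-th coordinate of \<open>x\<close> in \<open>[-1,1]\<close>,
  because the points of \<open>A\<close> have their j-th coordinates there.
\<close>

abbreviation "drop_gap j x \<equiv> sqdist A I x - sqdist A (I - {j}) x"

lemma coord_bound: "a \<in> A \<Longrightarrow> j \<in> I \<Longrightarrow> \<bar>a j\<bar> \<le> 1"
  using in_cube by (force simp: PiE_iff abs_le_iff)

lemma sqdist_cube_le:
  assumes x: "\<And>j. j \<in> I \<Longrightarrow> \<bar>x j\<bar> \<le> 1"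
  shows "sqdist A I x \<le> 4 * card I"
proof -
  obtain a where a: "a \<in> A" using nonempty by auto
  have "sqdist A I x \<le> (\<Sum>j\<in>I. (x j - a j)\<^sup>2)" by (rule sqdist_le[OF a])
  also have "\<dots> \<le> (\<Sum>j\<in>I. 2\<^sup>2)"
  proof (rule sum_mono)
    fix j assume "j \<in> I"
    then have "\<bar>x j - a j\<bar> \<le> \<bar>2\<bar>" using x coord_bound[OF a] by (smt (verit))
    then show "(x j - a j)\<^sup>2 \<le> 2\<^sup>2" by (simp only: abs_le_square_iff)
  qed
  finally show ?thesis by simp
qed

text \<open>Restoring the j-th coordinate adds \<open>(x j - b j)^2\<close> to the cost of each
  competitor \<open>b\<close>, and this lies between 0 and 4.\<close>

lemma drop_gap_bounds:
  assumes x: "\<And>j. j \<in> I \<Longrightarrow> \<bar>x j\<bar> \<le> 1" and j: "j \<in> I"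
  shows "0 \<le> drop_gap j x" "drop_gap j x \<le> 4"
proof -
  have split: "(\<Sum>l\<in>I. (x l - b l)\<^sup>2) = (x j - b j)\<^sup>2 + (\<Sum>l\<in>I - {j}. (x l - b l)\<^sup>2)" for b
    using finite_I j by (simp add: sum.remove)
  have "sqdist A (I - {j}) x \<le> sqdist A I x"
  proof (rule sqdist_ge[OF nonempty])
    fix b assume "b \<in> A"
    then have "sqdist A (I - {j}) x \<le> (\<Sum>l\<in>I - {j}. (x l - b l)\<^sup>2)" by (rule sqdist_le)
    then show "sqdist A (I - {j}) x \<le> (\<Sum>l\<in>I. (x l - b l)\<^sup>2)"
      unfolding split using zero_le_power2[of "x j - b j"] by linarith
  qed
  then show "0 \<le> drop_gap j x" by simp
  have "sqdist A I x - 4 \<le> sqdist A (I - {j}) x"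
  proof (rule sqdist_ge[OF nonempty])
    fix b assume b: "b \<in> A"
    have "\<bar>x j - b j\<bar> \<le> \<bar>2\<bar>" using x[OF j] coord_bound[OF b j] by linarith
    then have "(x j - b j)\<^sup>2 \<le> 2\<^sup>2" by (simp only: abs_le_square_iff)
    then show "sqdist A I x - 4 \<le> (\<Sum>l\<in>I - {j}. (x l - b l)\<^sup>2)"
      using sqdist_le[OF b, of I x] unfolding split by simp
  qed
  then show "drop_gap j x \<le> 4" by simp
qed

text \<open>Let \<open>a\<close> be a nearest point. Convexity gives the linear bound
  \<open>4 * \<bar>x j - a j\<bar>\<close> for the j-th gap, where the trivial competitor argument
  would not suffice; the squares then sum to 16 times the squared distance.\<close>

lemma sum_drop_gap_sq_le:
  assumes x: "\<And>j. j \<in> I \<Longrightarrow> \<bar>x j\<bar> \<le> 1"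
  shows "(\<Sum>j\<in>I. (drop_gap j x)\<^sup>2) \<le> 16 * sqdist A I x"
proof -
  have "continuous_on A (\<lambda>a. \<Sum>l\<in>I. (x l - a l)\<^sup>2)"
    by (intro continuous_intros continuous_on_subset[OF continuous_on_product_coordinates]) auto
  from continuous_attains_inf[OF compact_A nonempty this]
  obtain a where a: "a \<in> A" and min: "\<And>b. b \<in> A \<Longrightarrow> (\<Sum>l\<in>I. (x l - a l)\<^sup>2) \<le> (\<Sum>l\<in>I. (x l - b l)\<^sup>2)"
    by auto
  have Z: "sqdist A I x = (\<Sum>l\<in>I. (x l - a l)\<^sup>2)"
    using sqdist_le[OF a, of I x] sqdist_ge[OF nonempty min] by (intro antisym) auto
  \<comment> \<open>First-order optimality of the nearest point \<open>a\<close>.\<close>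
  have var: "(\<Sum>l\<in>I. (x l - a l) * (b l - a l)) \<le> 0" if b: "b \<in> A" for b
  proof (rule ccontr)
    define S where "S = (\<Sum>l\<in>I. (x l - a l) * (b l - a l))"
    define Q where "Q = (\<Sum>l\<in>I. (b l - a l)\<^sup>2)"
    assume "\<not> ?thesis"
    then have S: "S > 0" by (simp add: S_def)
    have Q: "Q \<ge> 0" by (simp add: Q_def sum_nonneg)
    \<comment> \<open>A step from \<open>a\<close> towards \<open>b\<close> so short that the
      quadratic cost \<open>t^2 * Q\<close> is at most the linear term \<open>t * S\<close>, half of
      the linear gain. Adding 1 to \<open>Q\<close> avoids division by 0.\<close>
    define t where "t = min 1 (S / (Q + 1))"
    have t: "0 < t" "t \<le> 1" "t \<le> S / (Q + 1)"
      using S Q by (auto simp: t_def)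
    have "(\<Sum>l\<in>I. (x l - a l)\<^sup>2) \<le> (\<Sum>l\<in>I. (x l - (\<lambda>i\<in>I. (1 - t) * a i + t * b i) l)\<^sup>2)"
      using min[OF convex_A[OF a b]] t by simp
    also have "\<dots> = (\<Sum>l\<in>I. (x l - a l)\<^sup>2 - 2 * t * ((x l - a l) * (b l - a l)) + t\<^sup>2 * (b l - a l)\<^sup>2)"
      by (intro sum.cong refl) (simp add: power2_eq_square algebra_simps)
    also have "\<dots> = (\<Sum>l\<in>I. (x l - a l)\<^sup>2) - 2 * t * S + t\<^sup>2 * Q"
      by (simp add: S_def Q_def sum.distrib sum_subtractf sum_distrib_left)
    finally have "2 * t * S \<le> t\<^sup>2 * Q" by simp
    then have "2 * S \<le> t * Q" using t by (simp add: power2_eq_square)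
    moreover have "t * Q \<le> S" using t Q by (simp add: pos_le_divide_eq algebra_simps)
    ultimately show False using S by simp
  qed
  have gap: "drop_gap j x \<le> 4 * \<bar>x j - a j\<bar>" if j: "j \<in> I" for j
  proof -
    have "sqdist A I x - 4 * \<bar>x j - a j\<bar> \<le> sqdist A (I - {j}) x"
    proof (rule sqdist_ge[OF nonempty])
      fix b assume b: "b \<in> A"
      \<comment> \<open>\<open>?r l\<close> is the linearization of \<open>(x l - b l)^2\<close> in
        \<open>b\<close> around \<open>a\<close>, smaller by the square
        \<open>(b l - a l)^2\<close>. By \<open>var\<close> its sum over \<open>I\<close> is at
        least the squared distance, so dropping the j-th term loses at most
        \<open>?r j\<close>.\<close>
      let ?r = "\<lambda>l. (x l - a l)\<^sup>2 - 2 * ((x l - a l) * (b l - a l))"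
      have "(\<Sum>l\<in>I. ?r l) = sqdist A I x - 2 * (\<Sum>l\<in>I. (x l - a l) * (b l - a l))"
        by (simp add: Z sum_subtractf sum_distrib_left)
      then have "sqdist A I x - ?r j \<le> (\<Sum>l\<in>I. ?r l) - ?r j" using var[OF b] by linarith
      also have "\<dots> = (\<Sum>l\<in>I - {j}. ?r l)"
        using finite_I j by (simp add: sum.remove[of I j ?r])
      also have "\<dots> \<le> (\<Sum>l\<in>I - {j}. (x l - b l)\<^sup>2)"
      proof (rule sum_mono)
        fix l
        have "(x l - b l)\<^sup>2 = ?r l + (b l - a l)\<^sup>2" by (simp add: power2_eq_square algebra_simps)
        then show "?r l \<le> (x l - b l)\<^sup>2" by simp
      qed
      finally have "sqdist A I x - ?r j \<le> (\<Sum>l\<in>I - {j}. (x l - b l)\<^sup>2)" .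
      moreover have "?r j \<le> 4 * \<bar>x j - a j\<bar>"
      proof -
        \<comment> \<open>The second factor has modulus at most 4, because all three numbers lie in
          \<open>[-1,1]\<close>.\<close>
        have "?r j = (x j - a j) * (x j + a j - 2 * b j)" by (simp add: power2_eq_square algebra_simps)
        also have "\<dots> \<le> \<bar>x j - a j\<bar> * \<bar>x j + a j - 2 * b j\<bar>" by (metis abs_ge_self abs_mult)
        also have "\<dots> \<le> \<bar>x j - a j\<bar> * 4"
          using x[OF j] coord_bound[OF a j] coord_bound[OF b j] by (intro mult_left_mono) linarith+
        finally show ?thesis by simp
      qed
      ultimately show "sqdist A I x - 4 * \<bar>x j - a j\<bar> \<le> (\<Sum>l\<in>I - {j}. (x l - b l)\<^sup>2)" by linarith
    qed
    then show ?thesis by simp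
  qed
  have "(\<Sum>j\<in>I. (drop_gap j x)\<^sup>2) \<le> (\<Sum>j\<in>I. (4 * \<bar>x j - a j\<bar>)\<^sup>2)"
    using gap drop_gap_bounds[OF x] by (intro sum_mono power_mono) auto
  also have "\<dots> = 16 * sqdist A I x"
    by (simp add: Z power_mult_distrib sum_distrib_left)
  finally show ?thesis .
qed

end

section \<open>Concentration\<close>

lemma stack_update:
  assumes "k < N" "i < n"
  shows "stack N n (z(k := (z k)(i := s))) = (stack N n z)((k, i) := s)"
  using assms by (auto simp: stack_def fun_eq_iff)

lemma stack_extensional [simp]: "stack N n z \<in> extensional ({..<N} \<times> {..<n})"
  by (simp add: stack_def)

locale AT_power =
  fixes n N :: nat and C :: real and \<mu> :: "(nat \<Rightarrow> real) measure"
  assumes prob_mu: "prob_space \<mu>" and sets_mu: "sets \<mu> = sets (cube {..<n})" and AT: "AT n C \<mu>"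
    and C_pos: "C > 0"
begin

abbreviation "P \<equiv> PiM {..<N} (\<lambda>_. \<mu>)"
abbreviation "J \<equiv> {..<N} \<times> {..<n}"

sublocale prob_space P
  by (rule prob_space_PiM) (rule prob_mu)

lemma space_mu: "space \<mu> = PiE {..<n} (\<lambda>_. {-1..1})"
  using sets_eq_imp_space_eq[OF sets_mu] by (simp add: space_PiM)

lemma coord_in:
  assumes "z \<in> space P" "k < N" "i < n"
  shows "z k i \<in> {-1..1}"
  using assms by (auto simp: space_PiM space_mu PiE_iff)

lemma stack_in: "z \<in> space P \<Longrightarrow> stack N n z \<in> PiE J (\<lambda>_. {-1..1})"
  using coord_in by (auto simp: stack_def PiE_iff)

lemma stack_abs_le: "z \<in> space P \<Longrightarrow> j \<in> J \<Longrightarrow> \<bar>stack N n z j\<bar> \<le> 1"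
  using stack_in[of z] by (force simp: PiE_iff abs_le_iff)

lemma stack_coord_measurable:
  assumes "j \<in> J"
  shows "(\<lambda>z. stack N n z j) \<in> borel_measurable P"
proof -
  obtain k i where j: "j = (k, i)" "k < N" "i < n" using assms by auto
  have "(\<lambda>x. x i) \<in> cube {..<n} \<rightarrow>\<^sub>M unit_seg"
    using j by (intro measurable_component_singleton) auto
  then have "(\<lambda>x. x i) \<in> borel_measurable \<mu>"
    using sets_mu by (simp add: measurable_restrict_space2_iff cong: measurable_cong_sets)
  from measurable_compose[OF measurable_component_singleton[of k "{..<N}" "\<lambda>_. \<mu>"] this]
  show ?thesis using j by (simp add: stack_def)
qed

lemma stack_measurable [measurable]: "stack N n \<in> borel_measurable P"
proof (rule measurable_coordinatewise_then_product)
  fix j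
  show "(\<lambda>z. stack N n z j) \<in> borel_measurable P"
  proof (cases "j \<in> J")
    case False
    then have "(\<lambda>z. stack N n z j) = (\<lambda>z. undefined)" by (auto simp: stack_def fun_eq_iff)
    then show ?thesis by simp
  qed (rule stack_coord_measurable)
qed

text \<open>
  The factor 16 comes from \<open>sum_drop_gap_sq_le\<close>. The factor \<open>e\<^sup>4\<close> bounds \<open>exp (- l * gap)\<close> for
  \<open>l \<ge> -1\<close>, as every gap is at most 4.
\<close>

definition rate :: real where "rate = 16 * exp 4 * C"

lemma rate_pos: "rate > 0"
  using C_pos by (simp add: rate_def)

section \<open>Exponential moments of the squared distance\<close>

context
  fixes A :: "(nat \<times> nat \<Rightarrow> real) set"
  assumes A: "convex_in_cube J A"
begin

interpretation A: convex_in_cube J A by (rule A)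

definition Z :: "(nat \<Rightarrow> nat \<Rightarrow> real) \<Rightarrow> real" where "Z z = sqdist A J (stack N n z)"

lemma Z_measurable [measurable]: "Z \<in> borel_measurable P"
  unfolding Z_def[abs_def] by (rule measurable_compose[OF stack_measurable sqdist_measurable[OF A.nonempty]])

lemma Z_bounds:
  assumes "z \<in> space P"
  shows "0 \<le> Z z" "Z z \<le> 4 * card J"
  using sqdist_nonneg[OF A.nonempty] A.sqdist_cube_le[OF stack_abs_le[OF assms]] by (auto simp: Z_def)

text \<open>Approximate tensorization is applied to \<open>exp (l * Z)\<close>, with the distance
  without \<open>(k, i)\<close> as the comparison function that ignores this coordinate.
  \<open>exp_rem_le\<close> leaves squared gaps, and \<open>sum_drop_gap_sq_le\<close> turns their
  sum back into \<open>Z\<close>.\<close>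

lemma real_ent_exp_Z_le:
  assumes l: "l \<ge> -1"
  shows "real_ent P (\<lambda>z. exp (l * Z z)) \<le> rate * l\<^sup>2 * (\<integral>z. Z z * exp (l * Z z) \<partial>P)"
proof -
  let ?B = "4 * card J"
  define g' where "g' k i z = l * sqdist A (J - {(k, i)}) (stack N n z)" for k i z
  have lZ: "\<bar>l * Z z\<bar> \<le> \<bar>l\<bar> * ?B" if "z \<in> space P" for z
    using Z_bounds[OF that] unfolding abs_mult by (intro mult_left_mono) auto
  have int: "integrable P (\<lambda>z. Z z * exp (l * Z z))"
  proof (rule integrable_bounded_on[where B = "?B * exp (\<bar>l\<bar> * ?B)"])
    fix z assume z: "z \<in> space P"
    show "\<bar>Z z * exp (l * Z z)\<bar> \<le> ?B * exp (\<bar>l\<bar> * ?B)"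
      unfolding abs_mult using Z_bounds[OF z] lZ[OF z] by (intro mult_mono) auto
  qed simp
  have pt: "(\<Sum>k<N. \<Sum>i<n. ennreal (exp (l * Z z) * exp_rem (g' k i z - l * Z z)))
      \<le> ennreal (16 * exp 4 * l\<^sup>2 * (Z z * exp (l * Z z)))" if z: "z \<in> space P" for z
  proof -
    let ?d = "\<lambda>j. sqdist A J (stack N n z) - sqdist A (J - {j}) (stack N n z)"
    note x = stack_abs_le[OF z]
    have "exp_rem (g' k i z - l * Z z) \<le> exp 4 * l\<^sup>2 * (?d (k, i))\<^sup>2" if "k < N" "i < n" for k i
    proof -
      have d: "0 \<le> ?d (k, i)" "?d (k, i) \<le> 4"
        using A.drop_gap_bounds[OF x, where j = "(k, i)"] that by auto
      have u: "g' k i z - l * Z z = (- l) * ?d (k, i)"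
        by (simp add: g'_def Z_def algebra_simps)
      have "(- l) * ?d (k, i) \<le> 1 * ?d (k, i)"
        using l d by (intro mult_right_mono) auto
      then have "max 1 (exp (g' k i z - l * Z z)) \<le> exp 4"
        unfolding u using d by auto
      then have "(g' k i z - l * Z z)\<^sup>2 * max 1 (exp (g' k i z - l * Z z)) \<le> (g' k i z - l * Z z)\<^sup>2 * exp 4"
        by (rule mult_left_mono) simp
      with exp_rem_le[of "g' k i z - l * Z z"] show ?thesis
        unfolding u by (simp add: power_mult_distrib mult_ac)
    qed
    then have "(\<Sum>k<N. \<Sum>i<n. exp (l * Z z) * exp_rem (g' k i z - l * Z z))
        \<le> (\<Sum>k<N. \<Sum>i<n. exp (l * Z z) * (exp 4 * l\<^sup>2 * (?d (k, i))\<^sup>2))"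
      by (intro sum_mono mult_left_mono) auto
    also have "\<dots> = exp (l * Z z) * exp 4 * l\<^sup>2 * (\<Sum>j\<in>J. (?d j)\<^sup>2)"
      by (simp add: sum.cartesian_product sum_distrib_left split_beta' mult_ac)
    also have "\<dots> \<le> exp (l * Z z) * exp 4 * l\<^sup>2 * (16 * sqdist A J (stack N n z))"
      by (intro mult_left_mono A.sum_drop_gap_sq_le[OF x]) auto
    also have "\<dots> = 16 * exp 4 * l\<^sup>2 * (Z z * exp (l * Z z))"
      by (simp add: Z_def)
    finally show ?thesis
      by (simp add: sum_nonneg exp_rem_nonneg ennreal_leI)
  qed
  have "ennreal (real_ent P (\<lambda>z. exp (l * Z z)))
      \<le> ennreal C * (\<integral>\<^sup>+z. (\<Sum>k<N. \<Sum>i<n. ennreal (exp (l * Z z) * exp_rem (g' k i z - l * Z z))) \<partial>P)"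
  proof (rule AT_real_ent_exp_PiM_le[OF prob_mu sets_mu AT])
    show "g' k i \<in> borel_measurable P" for k i
      unfolding g'_def[abs_def]
      by (intro borel_measurable_times borel_measurable_const
          measurable_compose[OF stack_measurable sqdist_measurable[OF A.nonempty]])
    show "g' k i (z(k := (z k)(i := s))) = g' k i z" if "k \<in> {..<N}" "i < n" for k i z s
    proof -
      have "k < N" using that by simp
      show ?thesis
        unfolding g'_def stack_update[OF \<open>k < N\<close> that(2)]
        by (intro arg_cong[where f = "(*) l"] sqdist_cong) auto
    qed
  qed (use lZ in auto)
  also have "\<dots> \<le> ennreal C * (\<integral>\<^sup>+z. ennreal (16 * exp 4 * l\<^sup>2 * (Z z * exp (l * Z z))) \<partial>P)"
    using pt by (intro mult_left_mono nn_integral_mono) auto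
  also have "(\<integral>\<^sup>+z. ennreal (16 * exp 4 * l\<^sup>2 * (Z z * exp (l * Z z))) \<partial>P)
      = ennreal (\<integral>z. 16 * exp 4 * l\<^sup>2 * (Z z * exp (l * Z z)) \<partial>P)"
    using int Z_bounds by (intro nn_integral_eq_integral) auto
  also have "ennreal C * \<dots> = ennreal (rate * l\<^sup>2 * (\<integral>z. Z z * exp (l * Z z) \<partial>P))"
    unfolding integral_mult_right_zero using C_pos by (simp add: rate_def mult_ac flip: ennreal_mult')
  finally show ?thesis
    using rate_pos Z_bounds
    by (subst (asm) ennreal_le_iff) (auto intro!: mult_nonneg_nonneg Bochner_Integration.integral_nonneg)
qed

lemma exp_moments:
  shows "(\<integral>z. exp (- Z z) \<partial>P) \<le> exp (- (\<integral>z. Z z \<partial>P) / (1 + rate))"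
    and "(\<integral>z. exp (Z z / (2 * rate)) \<partial>P) \<le> exp ((\<integral>z. Z z \<partial>P) / rate)"
proof -
  have "\<bar>Z z\<bar> \<le> 4 * card J" if "z \<in> space P" for z using Z_bounds[OF that] by simp
  from herbst[OF Z_measurable this rate_pos real_ent_exp_Z_le]
  show "(\<integral>z. exp (- Z z) \<partial>P) \<le> exp (- (\<integral>z. Z z \<partial>P) / (1 + rate))"
    "(\<integral>z. exp (Z z / (2 * rate)) \<partial>P) \<le> exp ((\<integral>z. Z z \<partial>P) / rate)" by auto
qed

lemma Z_integrable: "integrable P Z" "integrable P (\<lambda>z. exp (- Z z))" "integrable P (\<lambda>z. exp (Z z / (2 * rate)))"
proof -
  show "integrable P Z"
    using Z_bounds by (intro integrable_bounded_on[where B = "4 * card J"]) auto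
  show "integrable P (\<lambda>z. exp (- Z z))"
    using Z_bounds by (intro integrable_bounded_on[where B = 1]) auto
  show "integrable P (\<lambda>z. exp (Z z / (2 * rate)))"
  proof (rule integrable_bounded_on[where B = "exp (4 * card J / (2 * rate))"])
    fix z assume "z \<in> space P"
    from divide_right_mono[OF Z_bounds(2)[OF this], of "2 * rate"] rate_pos
    show "\<bar>exp (Z z / (2 * rate))\<bar> \<le> exp (4 * card J / (2 * rate))"
      by simp
  qed measurable
qed

text \<open>\<open>Z\<close> vanishes on \<open>A\<close>, so this is Markov's inequality for
  \<open>exp (- Z)\<close>. It is used in both directions: a large mean of \<open>Z\<close> makes
  \<open>A\<close> improbable, and a probable \<open>A\<close> keeps the mean of \<open>Z\<close>
  small.\<close>

lemma prob_in_le: "prob {z \<in> space P. stack N n z \<in> A} \<le> exp (- (\<integral>z. Z z \<partial>P) / (1 + rate))"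
proof -
  have sub: "{z \<in> space P. stack N n z \<in> A} \<subseteq> {z \<in> space P. 1 \<le> exp (- Z z)}"
    by (auto simp: Z_def sqdist_mem)
  have "prob {z \<in> space P. stack N n z \<in> A} \<le> prob {z \<in> space P. 1 \<le> exp (- Z z)}"
    by (rule finite_measure_mono[OF sub]) measurable
  also have "\<dots> \<le> (\<integral>z. exp (- Z z) \<partial>P) / 1"
    by (rule integral_Markov_inequality_measure[where A = "{}"]) (use Z_integrable in auto)
  finally show ?thesis using exp_moments(1) by simp
qed

lemma prob_far_le:
  "prob {z \<in> space P. T \<le> Z z} \<le> exp ((\<integral>z. Z z \<partial>P) / rate - T / (2 * rate))"
proof -
  have "{z \<in> space P. T \<le> Z z} = {z \<in> space P. exp (T / (2 * rate)) \<le> exp (Z z / (2 * rate))}"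
    using rate_pos by (auto simp: divide_right_mono divide_le_cancel)
  then have "prob {z \<in> space P. T \<le> Z z} \<le> (\<integral>z. exp (Z z / (2 * rate)) \<partial>P) / exp (T / (2 * rate))"
    using integral_Markov_inequality_measure[where A = "{}" and M = P and u = "\<lambda>z. exp (Z z / (2 * rate))" and c = "exp (T / (2 * rate))"]
      Z_integrable by auto
  also have "\<dots> \<le> exp ((\<integral>z. Z z \<partial>P) / rate) / exp (T / (2 * rate))"
    by (intro divide_right_mono exp_moments) auto
  finally show ?thesis by (simp add: exp_diff)
qed

end

section \<open>Deviations below and above a median\<close>

lemma tails:
  assumes L: "L > 0" and f: "convex_fun J f" "lipschitz_fun L J f" and t: "t > 0"
    and m: "is_median P (\<lambda>z. f (stack N n z)) m"
  shows "prob {z \<in> space P. f (stack N n z) \<le> m - t} \<le> exp (- (t\<^sup>2 / L\<^sup>2) / (4 * rate + 2))"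
    and "prob {z \<in> space P. m + t \<le> f (stack N n z)} \<le> exp (- (t\<^sup>2 / L\<^sup>2) / (4 * rate + 2))"
proof -
  define Y where "Y z = f (stack N n z)" for z
  \<comment> \<open>An \<open>L\<close>-Lipschitz function needs at least the squared distance
    \<open>T\<close> to change its value by \<open>t\<close>.\<close>
  define T where "T = t\<^sup>2 / L\<^sup>2"
  have T: "T > 0" using t L by (simp add: T_def)
  have finJ: "finite J" by simp
  have [measurable]: "Y \<in> borel_measurable P"
    unfolding Y_def[abs_def]
    by (rule lipschitz_fun_measurable[OF f(2) finJ stack_coord_measurable]) simp_all
  have med: "1/2 \<le> prob {z \<in> space P. Y z \<le> m}" "1/2 \<le> prob {z \<in> space P. m \<le> Y z}"
    using m by (auto simp: is_median_def Y_def)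
  have sub: "stack N n z \<in> cube_sublevel J f \<theta> \<longleftrightarrow> Y z \<le> \<theta>" if "z \<in> space P" for z \<theta>
    using stack_in[OF that] by (simp add: cube_sublevel_def Y_def)
  \<comment> \<open>Nonemptiness is a genuine condition: for the level \<open>m - t\<close> the
    empty case is treated separately, while at level \<open>m\<close> the median excludes
    it.\<close>
  have cic: "convex_in_cube J (cube_sublevel J f \<theta>)" if "cube_sublevel J f \<theta> \<noteq> {}" for \<theta>
  proof
    show "cube_sublevel J f \<theta> \<subseteq> PiE J (\<lambda>_. {-1..1})"
      by (auto simp: cube_sublevel_def)
  qed (rule finJ cube_sublevel_compact[OF f(2) finJ] that cube_sublevel_convex[OF f(1)]; assumption)+
  have far: "T \<le> Z (cube_sublevel J f \<theta>) z"
    if "cube_sublevel J f \<theta> \<noteq> {}" and z: "z \<in> space P" and ge: "\<theta> + t \<le> Y z" for \<theta> z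
    unfolding Z_def[OF cic[OF that(1)]]
  proof (rule sqdist_ge[OF that(1)])
    fix a assume a: "a \<in> cube_sublevel J f \<theta>"
    let ?x = "stack N n z"
    have "t \<le> \<bar>f ?x - f a\<bar>" using a ge by (auto simp: cube_sublevel_def Y_def)
    also have "\<dots> \<le> L * L2_set (\<lambda>j. ?x j - a j) J"
      using f(2) stack_in[OF z] a by (auto simp: lipschitz_fun_def cube_sublevel_def PiE_def)
    finally have "t / L \<le> L2_set (\<lambda>j. ?x j - a j) J" using L by (simp add: field_simps)
    then have "(t / L)\<^sup>2 \<le> (L2_set (\<lambda>j. ?x j - a j) J)\<^sup>2" using t L by (intro power_mono) auto
    then show "T \<le> (\<Sum>j\<in>J. (?x j - a j)\<^sup>2)"
      by (simp add: T_def power_divide L2_set_def sum_nonneg)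
  qed
  show "prob {z \<in> space P. f (stack N n z) \<le> m - t} \<le> exp (- (t\<^sup>2 / L\<^sup>2) / (4 * rate + 2))"
  proof (cases "cube_sublevel J f (m - t) = {}")
    case True
    then have "{z \<in> space P. f (stack N n z) \<le> m - t} = {}"
      using sub[of _ "m - t"] by (auto simp: Y_def)
    then show ?thesis by (simp only: measure_empty exp_ge_zero)
  next
    case False
    let ?A = "cube_sublevel J f (m - t)"
    note cic = cic[OF False]
    have "T * (1/2) \<le> T * prob {z \<in> space P. m \<le> Y z}"
      using med T by (intro mult_left_mono) auto
    also have "\<dots> = (\<integral>z. T * indicator {z \<in> space P. m \<le> Y z} z \<partial>P)" by simp
    also have "\<dots> \<le> (\<integral>z. Z ?A z \<partial>P)"
    proof (rule integral_mono)
      show "integrable P (\<lambda>z. T * indicator {z \<in> space P. m \<le> Y z} z)"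
        by (intro integrable_mult_right integrable_real_indicator) (measurable, simp add: less_top[symmetric])
      show "T * indicator {z \<in> space P. m \<le> Y z} z \<le> Z ?A z" if "z \<in> space P" for z
        using that far[OF False] Z_bounds(1)[OF cic] by (auto simp: indicator_def)
    qed (rule Z_integrable[OF cic])
    finally have EZ: "T / 2 \<le> (\<integral>z. Z ?A z \<partial>P)" by simp
    \<comment> \<open>The lower tail holds with the better denominator \<open>2 * rate + 2\<close>;
      the larger one is dictated by the upper tail.\<close>
    have "T / (4 * rate + 2) \<le> T / (2 * (1 + rate))"
      using T rate_pos by (intro divide_left_mono) auto
    also have "\<dots> = (T / 2) / (1 + rate)" by simp
    also have "\<dots> \<le> (\<integral>z. Z ?A z \<partial>P) / (1 + rate)"
      using EZ rate_pos by (intro divide_right_mono) auto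
    finally have "exp (- (\<integral>z. Z ?A z \<partial>P) / (1 + rate)) \<le> exp (- T / (4 * rate + 2))" by simp
    moreover have "prob {z \<in> space P. Y z \<le> m - t} \<le> exp (- (\<integral>z. Z ?A z \<partial>P) / (1 + rate))"
      using prob_in_le[OF cic] sub[of _ "m - t"] by (simp cong: conj_cong)
    ultimately show ?thesis unfolding T_def Y_def by (rule order_trans[rotated])
  qed
  show "prob {z \<in> space P. m + t \<le> f (stack N n z)} \<le> exp (- (t\<^sup>2 / L\<^sup>2) / (4 * rate + 2))"
  proof -
    let ?A = "cube_sublevel J f m" and ?U = "{z \<in> space P. m + t \<le> Y z}"
    have ne: "?A \<noteq> {}"
    proof
      assume "?A = {}"
      then have E: "{z \<in> space P. Y z \<le> m} = {}" using sub[of _ m] by auto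
      show False using med(1) unfolding E by simp
    qed
    note cic = cic[OF ne]
    \<comment> \<open>\<open>prob_in_le\<close> is read backwards here: the sublevel set at a median
      has probability at least 1/2, which bounds the mean of \<open>Z\<close>.\<close>
    have "1/2 \<le> exp (- (\<integral>z. Z ?A z \<partial>P) / (1 + rate))"
      using prob_in_le[OF cic] sub[of _ m] med(1) by (simp cong: conj_cong)
    then have "ln (1/2) \<le> - (\<integral>z. Z ?A z \<partial>P) / (1 + rate)"
      using ln_mono[of "1/2"] by fastforce
    then have EZ: "(\<integral>z. Z ?A z \<partial>P) \<le> (1 + rate) * ln 2"
      using rate_pos by (simp add: ln_div field_simps)
    have half: "prob ?U \<le> 1/2"
    proof -
      have "prob ?U \<le> prob (space P - {z \<in> space P. Y z \<le> m})"
        using t by (intro finite_measure_mono) auto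
      also have "\<dots> \<le> 1/2" using med(1) by (subst prob_compl) auto
      finally show ?thesis .
    qed
    have "prob ?U \<le> prob {z \<in> space P. T \<le> Z ?A z}"
      using far[OF ne] Z_measurable[OF cic] by (intro finite_measure_mono) auto
    also have "\<dots> \<le> exp ((\<integral>z. Z ?A z \<partial>P) / rate - T / (2 * rate))"
      by (rule prob_far_le[OF cic])
    also have "\<dots> \<le> exp ((1 + rate) * ln 2 / rate - T / (2 * rate))"
      using EZ rate_pos by (auto intro!: divide_right_mono)
    finally have up: "prob ?U \<le> exp ((1 + rate) * ln 2 / rate - T / (2 * rate))" .
    have "prob ?U \<le> exp (- T / (4 * rate + 2))"
      \<comment> \<open>\<open>up\<close> has a constant factor larger than 1, so small \<open>T\<close> is left to the trivial bound \<open>half\<close>.\<close>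
    proof (cases "T \<le> (4 * rate + 2) * ln 2")
      case True
      then have "T / (4 * rate + 2) \<le> ln 2" using rate_pos by (simp add: field_simps)
      then have "exp (- ln 2) \<le> exp (- T / (4 * rate + 2))" by simp
      then show ?thesis using half by (simp add: exp_minus)
    next
      case False
      then have "ln 2 - T / (4 * rate + 2) \<le> 0" using rate_pos by (simp add: field_simps)
      then have "(1 + rate) / rate * (ln 2 - T / (4 * rate + 2)) \<le> 0"
        using rate_pos by (intro mult_nonneg_nonpos) auto
      \<comment> \<open>This identity explains \<open>4 * rate + 2\<close>: at
        \<open>T = (4 * rate + 2) * ln 2\<close> the bound \<open>up\<close>, the trivial bound 1/2
        and the target all coincide, and for larger \<open>T\<close> the bound \<open>up\<close> is
        below the target.\<close>
      also have "(1 + rate) / rate * (ln 2 - T / (4 * rate + 2))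
          = (1 + rate) * ln 2 / rate - T / (2 * rate) + T / (4 * rate + 2)"
        using rate_pos by (simp add: divide_simps) (simp add: algebra_simps)
      finally have "(1 + rate) * ln 2 / rate - T / (2 * rate) \<le> - T / (4 * rate + 2)"
        by simp
      then show ?thesis using up by (meson exp_le_cancel_iff order_trans)
    qed
    then show ?thesis by (simp add: T_def Y_def)
  qed
qed

lemma convex_concentration_power: "convex_concentration J P (stack N n) (sqrt (4 * rate + 2))"
  unfolding convex_concentration_def
proof (intro allI impI, elim conjE)
  fix L :: real and f and t m :: real
  assume L: "0 < L" and f: "convex_fun J f" "lipschitz_fun L J f" and t: "0 < t"
    and m: "is_median P (\<lambda>z. f (stack N n z)) m"
  have [measurable]: "(\<lambda>z. f (stack N n z)) \<in> borel_measurable P"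
    by (rule lipschitz_fun_measurable[OF f(2) _ stack_coord_measurable]) simp_all
  have "{z \<in> space P. t \<le> \<bar>f (stack N n z) - m\<bar>}
      = {z \<in> space P. f (stack N n z) \<le> m - t} \<union> {z \<in> space P. m + t \<le> f (stack N n z)}"
    using t by (auto simp: abs_if split: if_splits)
  then have "prob {z \<in> space P. t \<le> \<bar>f (stack N n z) - m\<bar>}
      \<le> prob {z \<in> space P. f (stack N n z) \<le> m - t} + prob {z \<in> space P. m + t \<le> f (stack N n z)}"
    by (simp add: measure_subadditive)
  also have "\<dots> \<le> 2 * exp (- (t\<^sup>2 / L\<^sup>2) / (4 * rate + 2))"
    using tails[OF L f t m] by simp
  also have "- (t\<^sup>2 / L\<^sup>2) / (4 * rate + 2) = - (t\<^sup>2 / ((sqrt (4 * rate + 2))\<^sup>2 * L\<^sup>2))"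
    using rate_pos by (simp add: mult.commute)
  finally show "prob {z \<in> space P. t \<le> \<bar>f (stack N n z) - m\<bar>}
    \<le> 2 * exp (- (t\<^sup>2 / ((sqrt (4 * rate + 2))\<^sup>2 * L\<^sup>2)))" .
qed

end

theorem proposition5p4:
  fixes C :: real
  assumes "C > 0"
  shows "\<exists>K>0. \<forall>n\<ge>1. \<forall>\<mu>.
    prob_space \<mu> \<and> sets \<mu> = sets (cube {..<n}) \<and> AT n C \<mu> \<longrightarrow>
    dimension_free_convex_concentration n \<mu> K"
proof (intro exI[of _ "sqrt (4 * (16 * exp 4 * C) + 2)"] conjI allI impI)
  \<comment> \<open>The witness is \<open>sqrt (4 * rate + 2)\<close> with \<open>rate\<close>
    written out, since it has to be named before \<open>n\<close>, \<open>N\<close> and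
    \<open>\<mu>\<close> are fixed.\<close>
  show "sqrt (4 * (16 * exp 4 * C) + 2) > 0" using assms by (simp add: add_pos_pos)
  fix n :: nat and \<mu> :: "(nat \<Rightarrow> real) measure"
  assume "prob_space \<mu> \<and> sets \<mu> = sets (cube {..<n}) \<and> AT n C \<mu>"
  then interpret AT_power n N C \<mu> for N
    using assms by (elim conjE) (rule AT_power.intro)
  show "dimension_free_convex_concentration n \<mu> (sqrt (4 * (16 * exp 4 * C) + 2))"
    unfolding dimension_free_convex_concentration_def
    using convex_concentration_power by (simp add: rate_def)
qed

end
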